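(* Let $\mathcal X$ be an RD-space, let $\rho$ be an admissible function on $\mathcal X$, and let $\mathcal D$ be the collection of balls $B(z,r)$ with $r\ge\rho(z)$. For $f\in L^1_{\rm loc}(\mathcal X)$ and $x\in\mathcal X$ put $$\mathrm{HL}(f)(x)=\sup_{x\in B}|f|_B,\qquad M(f)(x)=\sup_{x\in B}f_B,\qquad \mathrm{HL}_\rho(f)(x)=\sup_{x\in B,\,B\notin\mathcal D}|f|_B,$$ where the suprema are over balls $B$ containing $x$ (with $B\notin\mathcal D$ in the last case). Then $\mathrm{HL}$, $\mathrm{HL}_\rho$ and $M$ are bounded from $\mathrm{BMO}_\rho(\mathcal X)$ to $\mathrm{BLO}_\rho(\mathcal X)$; namely, there exists a positive constant $C$ such that for all $f\in\mathrm{BMO}_\rho(\mathcal X)$, $\mathrm{HL}(f),\mathrm{HL}_\rho(f),M(f)\in\mathrm{BLO}_\rho(\mathcal X)$ and $$\|\mathrm{HL}(f)\|_{\mathrm{BLO}_\rho(\mathcal X)}+\|\mathrm{HL}_\rho(f)\|_{\mathrm{BLO}_\rho(\mathcal X)}+\|M(f)\|_{\mathrm{BLO}_\rho(\mathcal X)}\le C\|f\|_{\mathrm{BMO}_\rho(\mathcal X)}.$$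
   Context: RD-space: $(\mathcal X,d)$ is a metric space with a regular Borel measure $\mu$ such that all balls $B(x,r)=\{y: d(x,y)<r\}$ have finite and positive measure; $\mu$ is doubling, i.e. there is $A_1\ge1$ with $\mu(B(x,2r))\le A_1\mu(B(x,r))$ for all $x\in\mathcal X$, $r>0$; and there are $0<\kappa\le n$, $A_2\in(0,1]$, $A_3\in[1,\infty)$ such that $A_2\lambda^\kappa\mu(B(x,r))\le\mu(B(x,\lambda r))\le A_3\lambda^n\mu(B(x,r))$ for all $x\in\mathcal X$, $0<r\le \mathrm{diam}(\mathcal X)/2$ and $1\le\lambda\le \mathrm{diam}(\mathcal X)/(2r)$. Balls are understood together with their center and radius. Admissible function: $\rho:\mathcal X\to(0,\infty)$ is admissible if there are positive constants $C_0,k_0$ such that $\frac1{\rho(x)}\le C_0\frac1{\rho(y)}\left(1+\frac{d(x,y)}{\rho(y)}\right)^{k_0}$ for all $x,y\in\mathcal X$. Functions here are real-valued; $L^1_{\rm loc}(\mathcal X)$ means integrable on every ball; $f_B=\frac1{\mu(B)}\int_B f\,d\mu$ and $|f|_B=\frac1{\mu(B)}\int_B|f|\,d\mu$. The spaces consist of the $f\in L^1_{\rm loc}(\mathcal X)$ for which the following are finite: $$\|f\|_{\mathrm{BMO}_\rho(\mathcal X)}=\sup_{B\notin\mathcal D}\frac1{\mu(B)}\int_B|f-f_B|\,d\mu+\sup_{B\in\mathcal D}\frac1{\mu(B)}\int_B|f|\,d\mu,$$ $$\|f\|_{\mathrm{BLO}_\rho(\mathcal X)}=\sup_{B\notin\mathcal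 D}\frac1{\mu(B)}\int_B\left[f-\operatorname*{ess\,inf}_B f\right]d\mu+\sup_{B\in\mathcal D}\frac1{\mu(B)}\int_B|f|\,d\mu.$$ *)

theory Defs
  imports "HOL-Analysis.Analysis"
begin

text \<open>
  The metric space is the whole carrier type. A ball is a pair of a center and a positive radius,
  since membership in the collection \<open>large_balls\<close> depends on both and not only on the
  underlying point set.
\<close>

definition balls :: "('a::metric_space \<times> real) set" where
  "balls = {(z, r). 0 < r}"

text \<open>
  The library's \<open>diameter\<close> is real-valued and not meaningful for unbounded sets; here the
  diameter of the space may be \<open>\<infinity>\<close>.
\<close>

definition ediam :: "'a::metric_space itself \<Rightarrow> ereal" where
  "ediam _ = (SUP (x, y) \<in> (UNIV :: ('a \<times> 'a) set). ereal (dist x y))"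

text \<open>
  Regularity is taken in the sense usual for metric spaces: approximation from outside by open
  sets and from inside by closed sets. The domain of the measure contains the Borel sets and may
  be larger, so that Borel measures and their completions are both covered.
\<close>

definition regular_borel_measure :: "'a::metric_space measure \<Rightarrow> bool" where
  "regular_borel_measure \<mu> \<longleftrightarrow>
     sets borel \<subseteq> sets \<mu> \<and>
     (\<forall>A \<in> sets \<mu>.
        emeasure \<mu> A = (INF U \<in> {U. open U \<and> A \<subseteq> U}. emeasure \<mu> U) \<and>
        emeasure \<mu> A = (SUP F \<in> {F. closed F \<and> F \<subseteq> A}. emeasure \<mu> F))"

definition RD_space :: "'a::metric_space measure \<Rightarrow> bool" where
  "RD_space \<mu> \<longleftrightarrow>
     regular_borel_measure \<mu> \<and>
     (\<forall>x r. 0 < r \<longrightarrow> 0 < emeasure \<mu> (ball x r) \<and> emeasure \<mu> (ball x r) < \<infinity>) \<and>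
     (\<exists>A1\<ge>1. \<forall>x r. 0 < r \<longrightarrow>
        measure \<mu> (ball x (2 * r)) \<le> A1 * measure \<mu> (ball x r)) \<and>
     (\<exists>\<kappa> n A2 A3. 0 < \<kappa> \<and> \<kappa> \<le> n \<and> 0 < A2 \<and> A2 \<le> 1 \<and> 1 \<le> A3 \<and>
        (\<forall>x r l. 0 < r \<and> ereal r \<le> ediam TYPE('a) / 2 \<and>
                 1 \<le> l \<and> ereal l \<le> ediam TYPE('a) / ereal (2 * r) \<longrightarrow>
           A2 * (l powr \<kappa>) * measure \<mu> (ball x r) \<le> measure \<mu> (ball x (l * r)) \<and>
           measure \<mu> (ball x (l * r)) \<le> A3 * (l powr n) * measure \<mu> (ball x r)))"

definition admissible :: "('a::metric_space \<Rightarrow> real) \<Rightarrow> bool" where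
  "admissible \<rho> \<longleftrightarrow>
     (\<forall>x. 0 < \<rho> x) \<and>
     (\<exists>C0>0. \<exists>k0>0. \<forall>x y.
        1 / \<rho> x \<le> C0 * (1 / \<rho> y) * (1 + dist x y / \<rho> y) powr k0)"

definition large_balls :: "('a::metric_space \<Rightarrow> real) \<Rightarrow> ('a \<times> real) set" where
  "large_balls \<rho> = {(z, r) \<in> balls. \<rho> z \<le> r}"

definition L1_loc :: "'a::metric_space measure \<Rightarrow> ('a \<Rightarrow> real) set" where
  "L1_loc \<mu> = {f. \<forall>(z, r) \<in> balls. set_integrable \<mu> (ball z r) f}"

definition avg :: "'a measure \<Rightarrow> 'a set \<Rightarrow> ('a \<Rightarrow> real) \<Rightarrow> real" where
  "avg \<mu> B f = (LINT y:B|\<mu>. f y) / measure \<mu> B"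

text \<open>Averages of nonnegative functions with value \<open>\<infinity>\<close> allowed; they enter the norms.\<close>

definition nn_avg :: "'a measure \<Rightarrow> 'a set \<Rightarrow> ('a \<Rightarrow> ennreal) \<Rightarrow> ennreal" where
  "nn_avg \<mu> B g = (\<integral>\<^sup>+y\<in>B. g y \<partial>\<mu>) / emeasure \<mu> B"

definition ess_inf :: "'a measure \<Rightarrow> 'a set \<Rightarrow> ('a \<Rightarrow> real) \<Rightarrow> ereal" where
  "ess_inf \<mu> B f = Sup {a. AE y \<in> B in \<mu>. a \<le> ereal (f y)}"

definition BMO_norm ::
    "'a::metric_space measure \<Rightarrow> ('a \<Rightarrow> real) \<Rightarrow> ('a \<Rightarrow> real) \<Rightarrow> ennreal" where
  "BMO_norm \<mu> \<rho> f =
     (SUP (z, r) \<in> balls - large_balls \<rho>.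
        nn_avg \<mu> (ball z r) (\<lambda>y. ennreal \<bar>f y - avg \<mu> (ball z r) f\<bar>)) +
     (SUP (z, r) \<in> large_balls \<rho>. nn_avg \<mu> (ball z r) (\<lambda>y. ennreal \<bar>f y\<bar>))"

definition BMO :: "'a::metric_space measure \<Rightarrow> ('a \<Rightarrow> real) \<Rightarrow> ('a \<Rightarrow> real) set" where
  "BMO \<mu> \<rho> = {f \<in> L1_loc \<mu>. BMO_norm \<mu> \<rho> f < \<infinity>}"

text \<open>
  In the next definition the integrand is nonnegative almost everywhere on the ball, so that
  \<open>e2ennreal\<close> truncates nothing; it is \<open>\<infinity>\<close> if the essential infimum is
  \<open>-\<infinity>\<close>.
\<close>

definition BLO_norm ::
    "'a::metric_space measure \<Rightarrow> ('a \<Rightarrow> real) \<Rightarrow> ('a \<Rightarrow> real) \<Rightarrow> ennreal" where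
  "BLO_norm \<mu> \<rho> f =
     (SUP (z, r) \<in> balls - large_balls \<rho>.
        nn_avg \<mu> (ball z r) (\<lambda>y. e2ennreal (ereal (f y) - ess_inf \<mu> (ball z r) f))) +
     (SUP (z, r) \<in> large_balls \<rho>. nn_avg \<mu> (ball z r) (\<lambda>y. ennreal \<bar>f y\<bar>))"

definition BLO :: "'a::metric_space measure \<Rightarrow> ('a \<Rightarrow> real) \<Rightarrow> ('a \<Rightarrow> real) set" where
  "BLO \<mu> \<rho> = {f \<in> L1_loc \<mu>. BLO_norm \<mu> \<rho> f < \<infinity>}"

text \<open>
  The maximal functions are extended-real-valued: for \<open>f\<close> in \<open>BMO \<mu> \<rho>\<close> the
  suprema can be \<open>\<infinity>\<close> at the points of a null set.
\<close>

definition HL :: "'a::metric_space measure \<Rightarrow> ('a \<Rightarrow> real) \<Rightarrow> 'a \<Rightarrow> ereal" where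
  "HL \<mu> f x =
     (SUP (z, r) \<in> {(z, r) \<in> balls. x \<in> ball z r}. ereal (avg \<mu> (ball z r) (\<lambda>y. \<bar>f y\<bar>)))"

definition max_avg :: "'a::metric_space measure \<Rightarrow> ('a \<Rightarrow> real) \<Rightarrow> 'a \<Rightarrow> ereal" where
  "max_avg \<mu> f x =
     (SUP (z, r) \<in> {(z, r) \<in> balls. x \<in> ball z r}. ereal (avg \<mu> (ball z r) f))"

definition HL_loc ::
    "'a::metric_space measure \<Rightarrow> ('a \<Rightarrow> real) \<Rightarrow> ('a \<Rightarrow> real) \<Rightarrow> 'a \<Rightarrow> ereal" where
  "HL_loc \<mu> \<rho> f x =
     (SUP (z, r) \<in> {(z, r) \<in> balls - large_balls \<rho>. x \<in> ball z r}.
        ereal (avg \<mu> (ball z r) (\<lambda>y. \<bar>f y\<bar>)))"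

text \<open>
  An extended-real-valued function is regarded as a real-valued one if it is finite almost
  everywhere; its real-valued version \<open>real_of_ereal \<circ> g\<close> is \<open>0\<close> on the
  exceptional null set. Any other constant there gives the same membership and norm.
\<close>

definition in_BLO_ext ::
    "'a::metric_space measure \<Rightarrow> ('a \<Rightarrow> real) \<Rightarrow> ('a \<Rightarrow> ereal) \<Rightarrow> bool" where
  "in_BLO_ext \<mu> \<rho> g \<longleftrightarrow>
     (AE x in \<mu>. \<bar>g x\<bar> \<noteq> \<infinity>) \<and> real_of_ereal \<circ> g \<in> BLO \<mu> \<rho>"

end

theory Submission
  imports Defs
begin

text \<open>
  Write \<open>K\<close> for the BMO norm of \<open>f\<close>, and let \<open>g\<close> be \<open>f\<close> or \<open>\<lambda>y. \<bar>f y\<bar>\<close>; its mean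
  oscillation over every ball is at most \<open>4 * K\<close>. All three maximal functions have the form
  \<open>max_over \<mu> P g\<close>, the supremum of the averages of \<open>g\<close> over the balls in a family
  \<open>P\<close> that contain the given point.

  Fix a ball \<open>B\<close> of radius \<open>R\<close> and points \<open>x\<close>, \<open>y\<close> in it, and split the supremum at
  \<open>x\<close> by the radius. A ball of radius above \<open>R\<close> that contains \<open>x\<close> has a threefold dilate
  that contains \<open>y\<close>, and the two averages differ by a multiple of \<open>K\<close>. (For \<open>HL_loc\<close>
  the dilate may belong to \<open>large_balls \<rho>\<close>; then the average over the ball is itself at most a
  multiple of \<open>K\<close>, and the maximal function at \<open>y\<close> is nonnegative.) A ball of smaller radius
  has an average which differs from the average over \<open>B\<close> by at most the local maximal function
  \<open>locmax\<close> of \<open>g\<close> minus its average over \<open>B\<close>. So, if \<open>B\<close> is not in \<open>large_balls \<rho>\<close>,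
  the maximal function at \<open>x\<close> is at most its value at \<open>y\<close> plus a multiple of \<open>K\<close> plus
  \<open>locmax\<close> at \<open>x\<close>. Taking the essential infimum in \<open>y\<close> and the average in \<open>x\<close> bounds
  the lower oscillation, once the average of \<open>locmax\<close> over \<open>B\<close> is known to be at most a
  multiple of \<open>K\<close>. If \<open>B\<close> is in \<open>large_balls \<rho>\<close>, the same splitting bounds the average of
  the absolute value of the maximal function, because all averages over balls of radius above
  \<open>R\<close> are then bounded by a multiple of \<open>K\<close>.

  The estimate of \<open>locmax\<close> (lemma \<open>nn_integral_locmax_le\<close>) is the heart of the proof. A
  stopping argument (lemma \<open>stopping_balls\<close>) covers the part of \<open>B\<close> where \<open>locmax\<close>
  exceeds a fixed multiple of \<open>K\<close> by balls of total measure at most half of that of \<open>B\<close>, on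
  each of which \<open>locmax\<close> of \<open>B\<close> is at most \<open>locmax\<close> of the covering ball plus a multiple of
  \<open>K\<close>. Consequently the supremum over all balls of the averages of \<open>locmax\<close> is at most half
  of itself plus a multiple of \<open>K\<close>. After truncation the supremum is finite, and half of it can be
  subtracted.
\<close>

section \<open>A covering lemma\<close>

lemma ex_nearly_maximal:
  fixes S :: "real set"
  assumes "S \<noteq> {}" and S: "\<And>s. s \<in> S \<Longrightarrow> 0 < s \<and> s \<le> R"
  shows "\<exists>s\<in>S. \<forall>t\<in>S. t < 2 * s"
proof -
  have bdd: "bdd_above S"
    using S by (auto intro!: bdd_aboveI[of _ R])
  obtain s0 where "s0 \<in> S" using assms(1) by blast
  then have "0 < Sup S"
    using S[of s0] cSup_upper[OF _ bdd, of s0] by linarith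
  then have "Sup S / 2 < Sup S" by simp
  then obtain s where s: "s \<in> S" "Sup S / 2 < s"
    using less_cSup_iff[OF assms(1) bdd, of "Sup S / 2"] by auto
  then have "t < 2 * s" if "t \<in> S" for t
    using cSup_upper[OF that bdd] by linarith
  with s(1) show ?thesis by blast
qed

text \<open>
  The combinatorial half of Vitali's covering lemma, for arbitrary sets \<open>b i\<close> with a size
  \<open>s i\<close>. Zorn's lemma applies to the disjoint subfamilies that already dominate in size, up to
  a factor \<open>2\<close>, everything that they meet. If some \<open>b i\<close> met no member of a maximal such
  subfamily, a nearly largest set with this property could be added to it.
\<close>

lemma vitali_selection:
  fixes b :: "'i \<Rightarrow> 'a set" and s :: "'i \<Rightarrow> real"
  assumes nonempty: "\<And>i. i \<in> I \<Longrightarrow> b i \<noteq> {}"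
    and s: "\<And>i. i \<in> I \<Longrightarrow> 0 < s i \<and> s i \<le> R"
  obtains J where "J \<subseteq> I" "disjoint_family_on b J"
    "\<And>i. i \<in> I \<Longrightarrow> \<exists>j\<in>J. b i \<inter> b j \<noteq> {} \<and> s i \<le> 2 * s j"
proof -
  define meets where "meets i G \<longleftrightarrow> (\<exists>j\<in>G. b i \<inter> b j \<noteq> {})" for i G
  define \<A> where "\<A> = {G. G \<subseteq> I \<and> disjoint_family_on b G \<and>
    (\<forall>i\<in>I. meets i G \<longrightarrow> (\<exists>j\<in>G. b i \<inter> b j \<noteq> {} \<and> s i \<le> 2 * s j))}"
  have "\<exists>M\<in>\<A>. \<forall>X\<in>\<A>. M \<subseteq> X \<longrightarrow> X = M"
  proof (rule subset_Zorn')
    fix \<C> assume chain: "subset.chain \<A> \<C>"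
    then have mem: "X \<in> \<A>" if "X \<in> \<C>" for X
      using that unfolding subset.chain_def by blast
    have "disjoint_family_on b (\<Union>\<C>)"
      unfolding disjoint_family_on_def
    proof (intro ballI impI)
      fix i j assume "i \<in> \<Union>\<C>" "j \<in> \<Union>\<C>" "i \<noteq> j"
      then obtain X Y where XY: "X \<in> \<C>" "Y \<in> \<C>" "i \<in> X" "j \<in> Y" by blast
      then have "X \<subseteq> Y \<or> Y \<subseteq> X"
        using chain unfolding subset_chain_def by blast
      with XY obtain Z where "Z \<in> \<C>" "i \<in> Z" "j \<in> Z" by blast
      with mem \<open>i \<noteq> j\<close> show "b i \<inter> b j = {}"
        unfolding \<A>_def disjoint_family_on_def by blast
    qed
    moreover have "\<exists>j\<in>\<Union>\<C>. b i \<inter> b j \<noteq> {} \<and> s i \<le> 2 * s j"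
      if "i \<in> I" "meets i (\<Union>\<C>)" for i
    proof -
      from that obtain X where "X \<in> \<C>" "meets i X"
        unfolding meets_def by blast
      with mem[of X] \<open>i \<in> I\<close> show ?thesis
        unfolding \<A>_def by blast
    qed
    moreover have "\<Union>\<C> \<subseteq> I"
      using mem unfolding \<A>_def by blast
    ultimately show "\<Union>\<C> \<in> \<A>"
      unfolding \<A>_def by blast
  qed
  then obtain M where M: "M \<in> \<A>" and max: "\<And>X. X \<in> \<A> \<Longrightarrow> M \<subseteq> X \<Longrightarrow> X = M"
    by blast
  have "meets i M" if "i \<in> I" for i
  proof (rule ccontr)
    assume no: "\<not> meets i M"
    define N where "N = {i\<in>I. \<not> meets i M}"
    have "i \<in> N" using no that by (simp add: N_def)
    \<comment> \<open>Adding \<open>k\<close> keeps the domination: a set that meets \<open>b k\<close> but nothing in \<open>M\<close> has its index in \<open>N\<close>.\<close>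
    obtain k where k: "k \<in> N" "\<And>j. j \<in> N \<Longrightarrow> s j < 2 * s k"
      using ex_nearly_maximal[of "s ` N" R] s \<open>i \<in> N\<close> by (auto simp: N_def)
    have "insert k M \<in> \<A>"
    proof -
      have "disjoint_family_on b (insert k M)"
        using M k(1) unfolding \<A>_def disjoint_family_on_def N_def meets_def by blast
      moreover have "\<exists>j\<in>insert k M. b i \<inter> b j \<noteq> {} \<and> s i \<le> 2 * s j"
        if "i \<in> I" "meets i (insert k M)" for i
      proof (cases "meets i M")
        case True
        with M \<open>i \<in> I\<close> show ?thesis unfolding \<A>_def by blast
      next
        case False
        with that have "b i \<inter> b k \<noteq> {}" "i \<in> N"
          unfolding meets_def N_def by blast+
        with k(2)[of i] show ?thesis by (intro bexI[of _ k]) auto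
      qed
      ultimately show ?thesis
        using M k(1) unfolding \<A>_def N_def by blast
    qed
    with max have "insert k M = M" by blast
    with k(1) nonempty show False
      unfolding N_def meets_def by blast
  qed
  with M that show thesis
    unfolding \<A>_def by blast
qed

section \<open>Averages over balls of a doubling measure\<close>

lemma ball_subset_ball_if_dist_le:
  assumes "dist z w + r \<le> s"
  shows "ball z r \<subseteq> ball w s"
proof
  fix y assume "y \<in> ball z r"
  moreover have "dist w y \<le> dist z w + dist z y"
    by (metis dist_commute dist_triangle)
  ultimately show "y \<in> ball w s"
    using assms by simp
qed

locale doubling_space =
  fixes \<mu> :: "'a::metric_space measure" and A :: real
  assumes borel_sets: "sets borel \<subseteq> sets \<mu>"
    and ball_pos: "0 < r \<Longrightarrow> 0 < emeasure \<mu> (ball x r)"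
    and ball_finite: "0 < r \<Longrightarrow> emeasure \<mu> (ball x r) < \<infinity>"
    and A_ge_1: "1 \<le> A"
    and doubling: "0 < r \<Longrightarrow> measure \<mu> (ball x (2 * r)) \<le> A * measure \<mu> (ball x r)"
begin

lemma open_in_sets: "open U \<Longrightarrow> U \<in> sets \<mu>"
  using borel_sets by auto

lemma ball_in_sets [measurable, simp]: "ball x r \<in> sets \<mu>"
  by (simp add: open_in_sets)

lemma space_eq_UNIV [simp]: "space \<mu> = UNIV"
  using sets.sets_into_space[OF open_in_sets[OF open_UNIV]] by auto

lemma emeasure_ball: "0 < r \<Longrightarrow> emeasure \<mu> (ball x r) = ennreal (measure \<mu> (ball x r))"
  using ball_finite[of r x] by (simp add: emeasure_eq_ennreal_measure less_top)

lemma measure_ball_pos: "0 < r \<Longrightarrow> 0 < measure \<mu> (ball x r)"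
  using ball_pos[of r x] emeasure_ball[of r x] by simp

lemma fmeasurable_ball: "0 < r \<Longrightarrow> ball x r \<in> fmeasurable \<mu>"
  using ball_finite by (simp add: fmeasurable_def)

lemma doubling_iterate:
  assumes "0 < r"
  shows "measure \<mu> (ball x (2 ^ k * r)) \<le> A ^ k * measure \<mu> (ball x r)"
proof (induction k)
  case (Suc k)
  have "measure \<mu> (ball x (2 ^ Suc k * r)) \<le> A * measure \<mu> (ball x (2 ^ k * r))"
    using doubling[of "2 ^ k * r" x] assms by (simp add: mult.assoc)
  also have "\<dots> \<le> A * (A ^ k * measure \<mu> (ball x r))"
    using Suc A_ge_1 by (intro mult_left_mono) auto
  finally show ?case by (simp add: mult.assoc)
qed simp

text \<open>
  Every comparison of balls below goes through this form of doubling: after \<open>k\<close> doublings the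
  second ball engulfs the first one.
\<close>

lemma measure_ball_le:
  assumes "0 < s" "dist x w + r \<le> 2 ^ k * s"
  shows "measure \<mu> (ball x r) \<le> A ^ k * measure \<mu> (ball w s)"
proof -
  have "ball x r \<subseteq> ball w (2 ^ k * s)"
    by (rule ball_subset_ball_if_dist_le[OF assms(2)])
  then have "measure \<mu> (ball x r) \<le> measure \<mu> (ball w (2 ^ k * s))"
    using fmeasurable_ball[of "2 ^ k * s" w] assms(1) by (intro measure_mono_fmeasurable) auto
  also have "\<dots> \<le> A ^ k * measure \<mu> (ball w s)"
    using doubling_iterate assms(1) by blast
  finally show ?thesis .
qed

lemma L1_loc_integrable: "h \<in> L1_loc \<mu> \<Longrightarrow> 0 < r \<Longrightarrow> set_integrable \<mu> (ball z r) h"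
  unfolding L1_loc_def balls_def by auto

lemma L1_loc_const: "(\<lambda>_. c) \<in> L1_loc \<mu>"
  unfolding L1_loc_def balls_def set_integrable_def
  using ball_finite by (auto intro!: integrable_scaleR_left integrable_real_indicator)

lemma L1_loc_dev:
  assumes "h \<in> L1_loc \<mu>"
  shows "(\<lambda>y. \<bar>h y - c\<bar>) \<in> L1_loc \<mu>"
  using assms L1_loc_const[of c] unfolding L1_loc_def
  by (auto intro!: set_integrable_abs set_integral_diff(1))

lemma avg_mono:
  assumes "h \<in> L1_loc \<mu>" "h' \<in> L1_loc \<mu>" "0 < r" "\<And>y. h y \<le> h' y"
  shows "avg \<mu> (ball z r) h \<le> avg \<mu> (ball z r) h'"
  unfolding avg_def using assms measure_ball_pos[of r z]
  by (intro divide_right_mono set_integral_mono L1_loc_integrable) auto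

lemma avg_nonneg: "(\<And>y. 0 \<le> h y) \<Longrightarrow> 0 \<le> avg \<mu> B h"
  unfolding avg_def set_lebesgue_integral_def
  by (intro divide_nonneg_nonneg integral_nonneg_AE) auto

lemma avg_const: "0 < r \<Longrightarrow> avg \<mu> (ball z r) (\<lambda>_. c) = c"
  using measure_ball_pos[of r z] unfolding avg_def set_lebesgue_integral_def by simp

lemma avg_diff:
  assumes "h \<in> L1_loc \<mu>" "h' \<in> L1_loc \<mu>" "0 < r"
  shows "avg \<mu> (ball z r) (\<lambda>y. h y - h' y) = avg \<mu> (ball z r) h - avg \<mu> (ball z r) h'"
  unfolding avg_def using assms
  by (simp add: set_integral_diff L1_loc_integrable diff_divide_distrib)

lemma avg_add:
  assumes "h \<in> L1_loc \<mu>" "h' \<in> L1_loc \<mu>" "0 < r"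
  shows "avg \<mu> (ball z r) (\<lambda>y. h y + h' y) = avg \<mu> (ball z r) h + avg \<mu> (ball z r) h'"
  unfolding avg_def using assms
  by (simp add: set_integral_add L1_loc_integrable add_divide_distrib)

lemma L1_loc_add:
  assumes "h \<in> L1_loc \<mu>" "h' \<in> L1_loc \<mu>"
  shows "(\<lambda>y. h y + h' y) \<in> L1_loc \<mu>"
  using assms unfolding L1_loc_def by (auto intro!: set_integral_add(1))

lemma abs_avg_le:
  assumes "h \<in> L1_loc \<mu>" "0 < r"
  shows "\<bar>avg \<mu> (ball z r) h\<bar> \<le> avg \<mu> (ball z r) (\<lambda>y. \<bar>h y\<bar>)"
proof -
  have "\<bar>LINT y:ball z r|\<mu>. h y\<bar> \<le> (LINT y:ball z r|\<mu>. \<bar>h y\<bar>)"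
    using integral_abs_bound[of \<mu> "\<lambda>y. indicator (ball z r) y *\<^sub>R h y"]
    unfolding set_lebesgue_integral_def by (simp add: abs_mult)
  then show ?thesis
    using measure_ball_pos[OF assms(2), of z] unfolding avg_def
    by (simp add: divide_right_mono)
qed

lemma abs_avg_minus_le:
  assumes "h \<in> L1_loc \<mu>" "0 < r"
  shows "\<bar>avg \<mu> (ball z r) h - c\<bar> \<le> avg \<mu> (ball z r) (\<lambda>y. \<bar>h y - c\<bar>)"
proof -
  have "(\<lambda>y. h y - c) \<in> L1_loc \<mu>"
    using L1_loc_add[OF assms(1) L1_loc_const[of "-c"]] by simp
  from abs_avg_le[OF this assms(2), of z] show ?thesis
    using avg_diff[OF assms(1) L1_loc_const assms(2), of z c] avg_const[OF assms(2), of z c]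
    by simp
qed

lemma avg_dev_change_center:
  assumes "h \<in> L1_loc \<mu>" "0 < r"
  shows "avg \<mu> (ball z r) (\<lambda>y. \<bar>h y - c\<bar>)
    \<le> avg \<mu> (ball z r) (\<lambda>y. \<bar>h y - c'\<bar>) + \<bar>c' - c\<bar>"
proof -
  have "avg \<mu> (ball z r) (\<lambda>y. \<bar>h y - c\<bar>)
    \<le> avg \<mu> (ball z r) (\<lambda>y. \<bar>h y - c'\<bar> + \<bar>c' - c\<bar>)"
    using assms by (intro avg_mono L1_loc_add L1_loc_dev L1_loc_const) auto
  also have "\<dots> = avg \<mu> (ball z r) (\<lambda>y. \<bar>h y - c'\<bar>) + \<bar>c' - c\<bar>"
    using assms by (simp add: avg_add L1_loc_dev L1_loc_const avg_const)
  finally show ?thesis .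
qed

text \<open>
  Passing to a larger ball of comparable measure costs a power of the doubling constant, provided
  that the function is nonnegative. The two distance conditions say that the larger ball contains
  the smaller one, and is contained in its concentric dilate by \<open>2 ^ k\<close>.
\<close>

lemma avg_le_larger_ball:
  assumes h: "h \<in> L1_loc \<mu>" "\<And>y. 0 \<le> h y" and r: "0 < r" "0 < s"
    and sub: "dist z w + r \<le> s" and k: "dist w z + s \<le> 2 ^ k * r"
  shows "avg \<mu> (ball z r) h \<le> A ^ k * avg \<mu> (ball w s) h"
proof -
  let ?I = "\<lambda>z r. LINT y:ball z r|\<mu>. h y"
  have "ball z r \<subseteq> ball w s"
    by (rule ball_subset_ball_if_dist_le[OF sub])
  then have mono: "?I z r \<le> ?I w s"
    using h r L1_loc_integrable[OF h(1)] unfolding set_lebesgue_integral_def set_integrable_def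
    by (intro integral_mono) (auto simp: indicator_def)
  have "0 \<le> ?I w s"
    unfolding set_lebesgue_integral_def using h(2) by (intro integral_nonneg_AE) auto
  note pos = measure_ball_pos[OF r(1), of z] measure_ball_pos[OF r(2), of w]
  have "measure \<mu> (ball w s) \<le> A ^ k * measure \<mu> (ball z r)"
    by (rule measure_ball_le[OF r(1) k])
  then have "?I w s * measure \<mu> (ball w s) \<le> ?I w s * (A ^ k * measure \<mu> (ball z r))"
    using \<open>0 \<le> ?I w s\<close> by (rule mult_left_mono)
  then have "?I w s / measure \<mu> (ball z r) \<le> A ^ k * (?I w s / measure \<mu> (ball w s))"
    using pos by (simp add: field_simps)
  moreover have "?I z r / measure \<mu> (ball z r) \<le> ?I w s / measure \<mu> (ball z r)"
    using mono pos by (simp add: divide_right_mono)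
  ultimately show ?thesis unfolding avg_def by linarith
qed

lemma nn_integral_ball_eq_avg:
  assumes h: "h \<in> L1_loc \<mu>" "\<And>y. 0 \<le> h y" and r: "0 < r"
  shows "(\<integral>\<^sup>+y\<in>ball z r. ennreal (h y) \<partial>\<mu>)
    = ennreal (avg \<mu> (ball z r) h) * emeasure \<mu> (ball z r)"
proof -
  have "(\<integral>\<^sup>+y\<in>ball z r. ennreal (h y) \<partial>\<mu>)
      = (\<integral>\<^sup>+y. ennreal (indicator (ball z r) y *\<^sub>R h y) \<partial>\<mu>)"
    by (intro nn_integral_cong) (auto simp: indicator_def)
  also have "\<dots> = ennreal (LINT y:ball z r|\<mu>. h y)"
    using L1_loc_integrable[OF h(1) r, of z] h(2)
    unfolding set_lebesgue_integral_def set_integrable_def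
    by (intro nn_integral_eq_integral) auto
  also have "(LINT y:ball z r|\<mu>. h y) = avg \<mu> (ball z r) h * measure \<mu> (ball z r)"
    unfolding avg_def using measure_ball_pos[OF r, of z] by simp
  finally show ?thesis
    using avg_nonneg[OF h(2)] by (simp add: ennreal_mult emeasure_ball[OF r])
qed

lemma nn_avg_eq_avg:
  assumes h: "h \<in> L1_loc \<mu>" "\<And>y. 0 \<le> h y" and r: "0 < r"
  shows "nn_avg \<mu> (ball z r) (\<lambda>y. ennreal (h y)) = ennreal (avg \<mu> (ball z r) h)"
  unfolding nn_avg_def nn_integral_ball_eq_avg[OF assms]
  using ball_pos[OF r, of z] ball_finite[OF r, of z]
  by (simp add: ennreal_mult_divide_eq less_top)

lemma nn_avg_le_iff:
  assumes r: "0 < r"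
  shows "nn_avg \<mu> (ball z r) h \<le> c \<longleftrightarrow> (\<integral>\<^sup>+y\<in>ball z r. h y \<partial>\<mu>) \<le> c * emeasure \<mu> (ball z r)"
proof
  let ?m = "emeasure \<mu> (ball z r)" and ?i = "\<integral>\<^sup>+y\<in>ball z r. h y \<partial>\<mu>"
  have m: "0 < ?m" "?m < top"
    using ball_pos[OF r, of z] ball_finite[OF r, of z] by auto
  show "?i \<le> c * ?m" if "nn_avg \<mu> (ball z r) h \<le> c"
  proof -
    have "?i = ?i / ?m * ?m"
      using m by (simp add: ennreal_divide_times ennreal_divide_self)
    also have "\<dots> \<le> c * ?m"
      using that unfolding nn_avg_def by (rule mult_right_mono) simp
    finally show ?thesis .
  qed
  show "nn_avg \<mu> (ball z r) h \<le> c" if "?i \<le> c * ?m"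
    unfolding nn_avg_def using m that by (intro divide_le_posI_ennreal) (auto simp: mult.commute)
qed

text \<open>
  Uncentered maximal functions are lower semicontinuous: a superlevel set is a union of balls.
  Hence they are measurable although the supremum ranges over an uncountable family.
\<close>

lemma measurable_SUP_balls:
  fixes h :: "'a \<times> real \<Rightarrow> 'b::{complete_linorder, linorder_topology, second_countable_topology}"
  shows "(\<lambda>x. SUP p\<in>{p\<in>P. x \<in> ball (fst p) (snd p)}. h p) \<in> borel_measurable \<mu>"
proof (rule borel_measurableI_greater)
  fix c
  have "{x \<in> space \<mu>. c < (SUP p\<in>{p\<in>P. x \<in> ball (fst p) (snd p)}. h p)}
    = (\<Union>p\<in>{p\<in>P. c < h p}. ball (fst p) (snd p))"
    by (auto simp: less_SUP_iff) (metis mem_ball fst_conv snd_conv)+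
  also have "\<dots> \<in> sets \<mu>"
    by (intro open_in_sets) auto
  finally show "{x \<in> space \<mu>. c < (SUP p\<in>{p\<in>P. x \<in> ball (fst p) (snd p)}. h p)} \<in> sets \<mu>" .
qed

text \<open>
  The measures of the balls have bounded finite partial sums, and each of them is positive.
\<close>

lemma countable_disjoint_balls:
  fixes z :: "'i \<Rightarrow> 'a"
  assumes disj: "disjoint_family_on (\<lambda>i. ball (z i) (s i)) J"
    and s: "\<And>i. i \<in> J \<Longrightarrow> 0 < s i" and "0 < R"
    and sub: "\<And>i. i \<in> J \<Longrightarrow> ball (z i) (s i) \<subseteq> ball w R"
  shows "countable J"
proof -
  let ?m = "\<lambda>i. measure \<mu> (ball (z i) (s i))"
  have "sum ?m F \<le> measure \<mu> (ball w R)" if F: "F \<subseteq> J" "finite F" for F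
  proof -
    have "sum ?m F = measure \<mu> (\<Union>i\<in>F. ball (z i) (s i))"
      using F s ball_finite disjoint_family_on_mono[OF F(1) disj]
      by (intro measure_finite_Union[symmetric]) (auto simp: less_top[symmetric] subset_iff)
    also have "\<dots> \<le> measure \<mu> (ball w R)"
      using F sub fmeasurable_ball[OF \<open>0 < R\<close>]
      by (intro measure_mono_fmeasurable sets.finite_UN) auto
    finally show ?thesis .
  qed
  then have "?m summable_on J"
    by (intro nonneg_bdd_above_summable_on bdd_aboveI[of _ "measure \<mu> (ball w R)"]) auto
  then have "countable {i\<in>J. ?m i \<noteq> 0}"
    by (rule summable_countable_real)
  moreover have "{i\<in>J. ?m i \<noteq> 0} = J"
    using s measure_ball_pos by (force simp: less_le)
  ultimately show ?thesis by simp
qed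

end

section \<open>The local maximal function of a function of bounded mean oscillation\<close>

lemma measurable_nn_integral_count_space:
  fixes f :: "'i \<Rightarrow> 'a \<Rightarrow> ennreal"
  assumes "countable I" and [measurable]: "\<And>i. i \<in> I \<Longrightarrow> f i \<in> borel_measurable M"
  shows "(\<lambda>x. \<integral>\<^sup>+i. f i x \<partial>count_space I) \<in> borel_measurable M"
proof (cases "finite I")
  case True
  then show ?thesis by (simp add: nn_integral_count_space_finite)
next
  case False
  have "(\<integral>\<^sup>+i. f i x \<partial>count_space I) = (\<Sum>n. f (from_nat_into I n) x)" for x
    by (simp add: nn_integral_count_space_nat
      nn_integral_bij_count_space[symmetric, OF bij_betw_from_nat_into[OF \<open>countable I\<close> False]])
  moreover have "f (from_nat_into I n) \<in> borel_measurable M" for n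
    using False by (intro assms(2) from_nat_into) auto
  ultimately show ?thesis by simp
qed

text \<open>
  Strict positivity of \<open>K\<close> makes the stopping level below positive, so that it can serve as
  a divisor; oscillation zero is reached at the end by letting \<open>K\<close> decrease.
\<close>

locale mean_oscillation = doubling_space \<mu> A for \<mu> :: "'a::metric_space measure" and A +
  fixes g :: "'a \<Rightarrow> real" and K :: real
  assumes g_loc: "g \<in> L1_loc \<mu>"
    and K_pos: "0 < K"
    and osc: "0 < r \<Longrightarrow> avg \<mu> (ball z r) (\<lambda>y. \<bar>g y - avg \<mu> (ball z r) g\<bar>) \<le> K"
begin

definition dev :: "'a \<Rightarrow> real \<Rightarrow> 'a \<Rightarrow> real \<Rightarrow> real" where
  "dev z0 R z s = avg \<mu> (ball z s) (\<lambda>y. \<bar>g y - avg \<mu> (ball z0 R) g\<bar>)"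

text \<open>
  The local maximal function of \<open>g\<close> minus its average over the reference ball
  \<open>ball z0 R\<close>. The balls in the supremum may stick out of the reference ball, as do
  the balls that define the maximal functions to be estimated there; only their radius is limited.
\<close>

definition locmax :: "'a \<Rightarrow> real \<Rightarrow> 'a \<Rightarrow> ennreal" where
  "locmax z0 R x = (SUP p\<in>{p\<in>{p. 0 < snd p \<and> snd p \<le> R}. x \<in> ball (fst p) (snd p)}.
     ennreal (dev z0 R (fst p) (snd p)))"

lemma dev_le_locmax:
  "0 < s \<Longrightarrow> s \<le> R \<Longrightarrow> x \<in> ball z s \<Longrightarrow> ennreal (dev z0 R z s) \<le> locmax z0 R x"
  unfolding locmax_def by (rule SUP_upper2[of "(z, s)"]) auto

lemma locmax_measurable [measurable]: "locmax z0 R \<in> borel_measurable \<mu>"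
  unfolding locmax_def[abs_def] by (rule measurable_SUP_balls)

lemma dev_nonneg: "0 \<le> dev z0 R z s"
  unfolding dev_def by (rule avg_nonneg) simp

lemma avg_diff_le_dev:
  "0 < s \<Longrightarrow> \<bar>avg \<mu> (ball z s) g - avg \<mu> (ball z0 R) g\<bar> \<le> dev z0 R z s"
  unfolding dev_def by (rule abs_avg_minus_le[OF g_loc])

lemma dev_le_larger_ball:
  assumes "0 < r" "0 < s" "dist z w + r \<le> s" "dist w z + s \<le> 2 ^ k * r"
  shows "dev z0 R z r \<le> A ^ k * dev z0 R w s"
  unfolding dev_def using assms by (intro avg_le_larger_ball L1_loc_dev g_loc) auto

lemma avg_diff_nested:
  assumes "0 < r" "0 < s" "dist z w + r \<le> s" "dist w z + s \<le> 2 ^ k * r"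
  shows "\<bar>avg \<mu> (ball z r) g - avg \<mu> (ball w s) g\<bar> \<le> A ^ k * K"
proof -
  have "\<bar>avg \<mu> (ball z r) g - avg \<mu> (ball w s) g\<bar> \<le> dev w s z r"
    using assms(1) by (rule avg_diff_le_dev)
  also have "\<dots> \<le> A ^ k * dev w s w s"
    using assms by (rule dev_le_larger_ball)
  also have "\<dots> \<le> A ^ k * K"
    using osc[OF assms(2), of w] A_ge_1 unfolding dev_def by (intro mult_left_mono) auto
  finally show ?thesis .
qed

lemma dev_change_center:
  assumes "0 < s"
  shows "dev z0 R z s \<le> dev w r z s + \<bar>avg \<mu> (ball w r) g - avg \<mu> (ball z0 R) g\<bar>"
  unfolding dev_def by (rule avg_dev_change_center[OF g_loc assms])

text \<open>
  The average of \<open>g\<close> moves by a bounded multiple of \<open>K\<close> between a ball and its dilate.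
\<close>

lemma dev_dilate:
  assumes "0 < R"
  shows "dev z0 R z0 (8 * R) \<le> 2 * A ^ 3 * K"
proof -
  have "dev z0 R z0 (8 * R) \<le> dev z0 (8 * R) z0 (8 * R)
      + \<bar>avg \<mu> (ball z0 (8 * R)) g - avg \<mu> (ball z0 R) g\<bar>"
    using assms by (intro dev_change_center) simp
  also have "\<dots> \<le> K + A ^ 3 * K"
    using osc[of "8 * R" z0] avg_diff_nested[of R "8 * R" z0 z0 3] assms
    unfolding dev_def by (simp add: abs_minus_commute)
  also have "\<dots> \<le> 2 * A ^ 3 * K"
    using K_pos one_le_power[OF A_ge_1, of 3] by (simp add: algebra_simps)
  finally show ?thesis .
qed

text \<open>
  A ball near \<open>ball z0 R\<close> and of comparable radius has small deviation. In the stopping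
  argument this covers the balls which are too large to be controlled by the maximality of the
  stopping radius.
\<close>

lemma dev_comparable:
  assumes "0 < R" "0 < s" "dist z z0 + s \<le> 8 * R" "dist z0 z + 8 * R \<le> 128 * s"
  shows "dev z0 R z s \<le> 2 * A ^ 10 * K"
proof -
  have "dev z0 R z s \<le> A ^ 7 * dev z0 R z0 (8 * R)"
    using assms by (intro dev_le_larger_ball) auto
  also have "\<dots> \<le> A ^ 7 * (2 * A ^ 3 * K)"
    using dev_dilate[OF assms(1)] A_ge_1 by (intro mult_left_mono) auto
  also have "\<dots> = 2 * A ^ 10 * K"
    by (simp add: power_add[symmetric] field_simps)
  finally show ?thesis .
qed

text \<open>
  The factor \<open>4\<close> and the exponent \<open>10\<close> make the stopping balls fill at most half of the
  reference ball, and put the level above the bound in \<open>dev_comparable\<close>.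
\<close>

definition stop_level :: real where "stop_level = 4 * A ^ 10 * K"

lemma stop_level_pos: "0 < stop_level"
  unfolding stop_level_def using A_ge_1 K_pos by simp

lemma stop_level_le: "stop_level \<le> A\<^sup>2 * stop_level"
  using stop_level_pos one_le_power[OF A_ge_1, of 2] by simp

text \<open>
  The Calderon--Zygmund step. Each point where the local maximal function exceeds the stopping
  level lies in a ball with large deviation and nearly largest possible radius. Dilating by
  \<open>5\<close> the disjoint balls that Vitali selection leaves gives a cover.

  The cover is small because each selected ball carries deviation at least the stopping level
  times its measure, while the total deviation over a dilate of the reference ball is bounded.

  On a covering ball the reference average may be replaced by the average over that ball. Balls of
  larger radius have deviation of the order of the stopping level, because their dilates were
  rejected when the stopping radius was chosen or are comparable to the reference ball. Balls of
  smaller radius are seen by the local maximal function of the covering ball.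
\<close>

lemma stopping_balls:
  assumes R: "0 < R"
  shows "\<exists>(J :: 'a set) w r. countable J \<and> (\<forall>j\<in>J. 0 < r j) \<and>
    (\<integral>\<^sup>+j. emeasure \<mu> (ball (w j) (r j)) \<partial>count_space J) \<le> ennreal (1 / 2) * emeasure \<mu> (ball z0 R) \<and>
    (\<forall>x\<in>ball z0 R. locmax z0 R x \<le> stop_level \<or>
      (\<exists>j\<in>J. x \<in> ball (w j) (r j) \<and> locmax z0 R x \<le> locmax (w j) (r j) x + ennreal (A\<^sup>2 * stop_level)))"
proof -
  define E where "E = {x \<in> ball z0 R. ennreal stop_level < locmax z0 R x}"
  have "\<exists>p. 0 < snd p \<and> snd p \<le> R \<and> x \<in> ball (fst p) (snd p) \<and> stop_level < dev z0 R (fst p) (snd p) \<and>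
      (\<forall>z' s'. 2 * snd p \<le> s' \<longrightarrow> s' \<le> R \<longrightarrow> x \<in> ball z' s' \<longrightarrow> dev z0 R z' s' \<le> stop_level)"
    if "x \<in> E" for x
  proof -
    define S where "S = {s. 0 < s \<and> s \<le> R \<and> (\<exists>z. x \<in> ball z s \<and> stop_level < dev z0 R z s)}"
    have "S \<noteq> {}"
      using that stop_level_pos unfolding E_def locmax_def S_def
      by (auto simp: less_SUP_iff ennreal_less_iff)
    then obtain s where s: "s \<in> S" "\<And>t. t \<in> S \<Longrightarrow> t < 2 * s"
      using ex_nearly_maximal[of S R] unfolding S_def by blast
    from s(1) obtain z where z: "x \<in> ball z s" "stop_level < dev z0 R z s" "0 < s" "s \<le> R"
      unfolding S_def by blast
    have "dev z0 R z' s' \<le> stop_level" if "2 * s \<le> s'" "s' \<le> R" "x \<in> ball z' s'" for z' s'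
      using s(2)[of s'] that z(3) unfolding S_def by (auto simp: not_less[symmetric])
    with z show ?thesis by (intro exI[of _ "(z, s)"]) auto
  qed
  then have "\<forall>x\<in>E. \<exists>p. 0 < snd p \<and> snd p \<le> R \<and> x \<in> ball (fst p) (snd p) \<and>
      stop_level < dev z0 R (fst p) (snd p) \<and>
      (\<forall>z' s'. 2 * snd p \<le> s' \<longrightarrow> s' \<le> R \<longrightarrow> x \<in> ball z' s' \<longrightarrow> dev z0 R z' s' \<le> stop_level)"
    by blast
  from bchoice[OF this] obtain p where
    p: "\<forall>x\<in>E. 0 < snd (p x) \<and> snd (p x) \<le> R \<and> x \<in> ball (fst (p x)) (snd (p x)) \<and>
      stop_level < dev z0 R (fst (p x)) (snd (p x)) \<and>
      (\<forall>z' s'. 2 * snd (p x) \<le> s' \<longrightarrow> s' \<le> R \<longrightarrow> x \<in> ball z' s' \<longrightarrow> dev z0 R z' s' \<le> stop_level)"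
    by blast
  define w s where "w x = fst (p x)" and "s x = snd (p x)" for x
  have s: "0 < s x" "s x \<le> R" "dist (w x) x < s x" "stop_level < dev z0 R (w x) (s x)"
      "\<And>z' s'. 2 * s x \<le> s' \<Longrightarrow> s' \<le> R \<Longrightarrow> dist z' x < s' \<Longrightarrow> dev z0 R z' s' \<le> stop_level"
    if "x \<in> E" for x
    using p that unfolding w_def s_def by auto
  have E: "dist z0 x < R" if "x \<in> E" for x
    using that unfolding E_def by auto
  have w: "dist (w x) z0 < 2 * R" if "x \<in> E" for x
    using s(2,3)[OF that] E[OF that] dist_triangle[of "w x" z0 x] by (simp add: dist_commute)
  have s': "0 < s i \<and> s i \<le> R" if "i \<in> E" for i
    using s(1,2) that by blast
  have ne: "ball (w i) (s i) \<noteq> {}" if "i \<in> E" for i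
    using s(1)[OF that] by auto
  obtain J where J: "J \<subseteq> E" "disjoint_family_on (\<lambda>i. ball (w i) (s i)) J"
    and cover: "\<And>i. i \<in> E \<Longrightarrow> \<exists>j\<in>J. ball (w i) (s i) \<inter> ball (w j) (s j) \<noteq> {} \<and> s i \<le> 2 * s j"
    using vitali_selection[of E "\<lambda>i. ball (w i) (s i)" s R, OF ne s'] by blast
  have sub: "ball (w i) (s i) \<subseteq> ball z0 (8 * R)" if "i \<in> J" for i
    using w[of i] s(2)[of i] that J(1) R by (intro ball_subset_ball_if_dist_le) auto
  have "countable J"
    using J sub R s(1) by (intro countable_disjoint_balls[of w s J "8 * R" z0]) auto
  moreover have "0 < 5 * s j" if "j \<in> J" for j
    using s(1) J(1) that by auto
  moreover have "(\<integral>\<^sup>+j. emeasure \<mu> (ball (w j) (5 * s j)) \<partial>count_space J)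
      \<le> ennreal (1 / 2) * emeasure \<mu> (ball z0 R)"
  proof -
    define h where "h y = \<bar>g y - avg \<mu> (ball z0 R) g\<bar>" for y
    have h: "h \<in> L1_loc \<mu>" "\<And>y. 0 \<le> h y"
      unfolding h_def by (auto intro: L1_loc_dev g_loc)
    \<comment> \<open>The sum of the deviations over the disjoint balls is the mass of their union for a measure with density.\<close>
    define \<nu> where "\<nu> = density \<mu> (\<lambda>y. ennreal (indicator (ball z0 (8 * R)) y *\<^sub>R h y))"
    have meas: "(\<lambda>y. ennreal (indicator (ball z0 (8 * R)) y *\<^sub>R h y)) \<in> borel_measurable \<mu>"
      using L1_loc_integrable[OF h(1), of "8 * R" z0] R unfolding set_integrable_def
      by (intro measurable_compose[OF borel_measurable_integrable measurable_ennreal]) auto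
    have \<nu>_ball: "emeasure \<nu> (ball z r) = ennreal (dev z0 R z r) * emeasure \<mu> (ball z r)"
      if "ball z r \<subseteq> ball z0 (8 * R)" "0 < r" for z r
    proof -
      have "emeasure \<nu> (ball z r) = (\<integral>\<^sup>+y\<in>ball z r. ennreal (h y) \<partial>\<mu>)"
        unfolding \<nu>_def using that
        by (subst emeasure_density[OF meas]) (auto intro!: nn_integral_cong simp: indicator_def)
      also have "\<dots> = ennreal (dev z0 R z r) * emeasure \<mu> (ball z r)"
        using nn_integral_ball_eq_avg[OF h that(2), of z] unfolding dev_def h_def .
      finally show ?thesis .
    qed
    have each: "emeasure \<mu> (ball (w j) (5 * s j)) \<le> ennreal (A ^ 3 / stop_level) * emeasure \<nu> (ball (w j) (s j))"
      if "j \<in> J" for j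
    proof -
      have j: "j \<in> E" using that J(1) by blast
      have "measure \<mu> (ball (w j) (5 * s j)) \<le> A ^ 3 * measure \<mu> (ball (w j) (s j))"
        using s(1)[OF j] by (intro measure_ball_le) auto
      also have "\<dots> = A ^ 3 / stop_level * (stop_level * measure \<mu> (ball (w j) (s j)))"
        using stop_level_pos by simp
      also have "\<dots> \<le> A ^ 3 / stop_level * (dev z0 R (w j) (s j) * measure \<mu> (ball (w j) (s j)))"
        using s(4)[OF j] stop_level_pos A_ge_1 by (intro mult_left_mono mult_right_mono) auto
      finally have "ennreal (measure \<mu> (ball (w j) (5 * s j)))
          \<le> ennreal (A ^ 3 / stop_level * (dev z0 R (w j) (s j) * measure \<mu> (ball (w j) (s j))))"
        by (rule ennreal_leI)
      also have "\<dots> = ennreal (A ^ 3 / stop_level) * (ennreal (dev z0 R (w j) (s j)) * ennreal (measure \<mu> (ball (w j) (s j))))"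
        using stop_level_pos A_ge_1 dev_nonneg by (simp add: ennreal_mult del: times_divide_eq_left)
      finally show ?thesis
        using s(1)[OF j] by (simp add: emeasure_ball \<nu>_ball[OF sub[OF that]])
    qed
    have "(\<integral>\<^sup>+j. emeasure \<mu> (ball (w j) (5 * s j)) \<partial>count_space J)
        \<le> (\<integral>\<^sup>+j. ennreal (A ^ 3 / stop_level) * emeasure \<nu> (ball (w j) (s j)) \<partial>count_space J)"
      using each by (intro nn_integral_mono) auto
    also have "\<dots> = ennreal (A ^ 3 / stop_level) * (\<integral>\<^sup>+j. emeasure \<nu> (ball (w j) (s j)) \<partial>count_space J)"
      by (rule nn_integral_cmult) auto
    also have "(\<integral>\<^sup>+j. emeasure \<nu> (ball (w j) (s j)) \<partial>count_space J)
        = emeasure \<nu> (\<Union>j\<in>J. ball (w j) (s j))"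
      using J \<open>countable J\<close> by (intro emeasure_UN_countable[symmetric]) (auto simp: \<nu>_def)
    also have "\<dots> \<le> emeasure \<nu> (ball z0 (8 * R))"
      using sub by (intro emeasure_mono) (auto simp: \<nu>_def)
    also have "\<dots> = ennreal (dev z0 R z0 (8 * R) * measure \<mu> (ball z0 (8 * R)))"
      using R dev_nonneg by (simp add: \<nu>_ball emeasure_ball ennreal_mult)
    also have "\<dots> \<le> ennreal (2 * A ^ 3 * K * (A ^ 3 * measure \<mu> (ball z0 R)))"
      using dev_dilate[OF R, of z0] doubling_iterate[OF R, of z0 3] K_pos A_ge_1 dev_nonneg
      by (intro ennreal_leI mult_mono) auto
    also have "ennreal (A ^ 3 / stop_level) * \<dots>
        = ennreal (A ^ 3 / stop_level * (2 * A ^ 3 * K * (A ^ 3 * measure \<mu> (ball z0 R))))"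
      using stop_level_pos A_ge_1 K_pos by (intro ennreal_mult[symmetric]) auto
    also have "A ^ 3 / stop_level * (2 * A ^ 3 * K * (A ^ 3 * measure \<mu> (ball z0 R)))
        = 1 / (2 * A) * measure \<mu> (ball z0 R)"
      unfolding stop_level_def using A_ge_1 K_pos by (simp add: field_simps flip: power_Suc power_add)
    also have "ennreal \<dots> \<le> ennreal (1 / 2 * measure \<mu> (ball z0 R))"
      using A_ge_1 by (intro ennreal_leI mult_right_mono) (auto simp: field_simps)
    also have "\<dots> = ennreal (1 / 2) * emeasure \<mu> (ball z0 R)"
      using R emeasure_ball by (subst ennreal_mult) auto
    finally show ?thesis
      by (simp add: mult_left_mono)
  qed
  moreover have "\<exists>j\<in>J. x \<in> ball (w j) (5 * s j) \<and>
      locmax z0 R x \<le> locmax (w j) (5 * s j) x + ennreal (A\<^sup>2 * stop_level)"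
    if x: "x \<in> ball z0 R" and not_small: "\<not> locmax z0 R x \<le> stop_level" for x
  proof -
    have "x \<in> E" using that unfolding E_def by auto
    from cover[OF this] obtain j u where j: "j \<in> J" "s x \<le> 2 * s j"
      and u: "dist (w x) u < s x" "dist (w j) u < s j"
      by auto
    have "j \<in> E" using j(1) J(1) by blast
    note sj = s[OF this]
    have xj: "dist (w j) x < 5 * s j"
      using dist_triangle[of "w j" x u] dist_triangle[of u x "w x"] u j(2) s(3)[OF \<open>x \<in> E\<close>]
      by (simp add: dist_commute)
    have cmp: "2 * A ^ 10 * K \<le> stop_level"
      unfolding stop_level_def using A_ge_1 K_pos by simp
    \<comment> \<open>The averages over the covering ball and over the reference ball are close, since the covering ball contains \<open>j\<close> and is too large to have been chosen for it, or else is comparable to the reference ball.\<close>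
    have mean: "\<bar>avg \<mu> (ball (w j) (5 * s j)) g - avg \<mu> (ball z0 R) g\<bar> \<le> stop_level"
    proof -
      have "dev z0 R (w j) (5 * s j) \<le> stop_level"
      proof (cases "5 * s j \<le> R")
        case True
        then show ?thesis using sj by (intro sj(5)) auto
      next
        case False
        then have "dev z0 R (w j) (5 * s j) \<le> 2 * A ^ 10 * K"
          using R sj(1,2) w[OF \<open>j \<in> E\<close>] by (intro dev_comparable) (auto simp: dist_commute)
        with cmp show ?thesis by linarith
      qed
      with avg_diff_le_dev[of "5 * s j" "w j" z0 R] sj(1) show ?thesis by linarith
    qed
    have "ennreal (dev z0 R z t) \<le> locmax (w j) (5 * s j) x + ennreal (A\<^sup>2 * stop_level)"
      if t: "0 < t" "t \<le> R" "dist z x < t" for z t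
    proof (cases "t \<le> 5 * s j")
      case True
      have "dev z0 R z t \<le> dev (w j) (5 * s j) z t + A\<^sup>2 * stop_level"
        using dev_change_center[OF t(1), of z0 R z "w j" "5 * s j"] mean stop_level_le by linarith
      then have "ennreal (dev z0 R z t) \<le> ennreal (dev (w j) (5 * s j) z t + A\<^sup>2 * stop_level)"
        by (rule ennreal_leI)
      also have "\<dots> = ennreal (dev (w j) (5 * s j) z t) + ennreal (A\<^sup>2 * stop_level)"
        using dev_nonneg stop_level_pos by (intro ennreal_plus) auto
      also have "\<dots> \<le> locmax (w j) (5 * s j) x + ennreal (A\<^sup>2 * stop_level)"
        using t True by (intro add_right_mono dev_le_locmax) auto
      finally show ?thesis .
    next
      case False
      \<comment> \<open>If the threefold dilate has radius at most \<open>R\<close>, it was rejected for the point \<open>j\<close>, which it contains; otherwise \<open>ball z t\<close> is comparable to the reference ball.\<close>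
      have "dev z0 R z t \<le> A\<^sup>2 * stop_level"
      proof (cases "3 * t \<le> R")
        case True
        have "dist z j < 3 * t"
          using dist_triangle[of z j x] dist_triangle[of x j "w j"] t(3) xj sj(1,3) False
          by (simp add: dist_commute)
        then have "dev z0 R z (3 * t) \<le> stop_level"
          using True False sj(1) by (intro sj(5)) auto
        then have "A\<^sup>2 * dev z0 R z (3 * t) \<le> A\<^sup>2 * stop_level"
          by (intro mult_left_mono) auto
        with dev_le_larger_ball[of t "3 * t" z z 2 z0 R] t(1) show ?thesis by simp
      next
        case False
        have "dist z z0 < 2 * R"
          using dist_triangle[of z z0 x] t x by (simp add: dist_commute)
        then have "dev z0 R z t \<le> 2 * A ^ 10 * K"
          using R t False by (intro dev_comparable) (auto simp: dist_commute)
        with cmp stop_level_le show ?thesis by linarith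
      qed
      then have "ennreal (dev z0 R z t) \<le> ennreal (A\<^sup>2 * stop_level)"
        by (rule ennreal_leI)
      then show ?thesis by (simp add: add_increasing)
    qed
    then have "locmax z0 R x \<le> locmax (w j) (5 * s j) x + ennreal (A\<^sup>2 * stop_level)"
      unfolding locmax_def[of z0 R x] by (intro SUP_least) auto
    with j(1) xj show ?thesis by (intro bexI[of _ j]) auto
  qed
  ultimately show ?thesis
    by (intro exI[of _ J] exI[of _ w] exI[of _ "\<lambda>j. 5 * s j"] conjI ballI disjCI) blast+
qed

text \<open>
  Let \<open>I\<close> be the supremum of the averages of the truncated local maximal functions over all
  reference balls. The stopping balls bound the average over one ball by the stopping level plus half
  of \<open>I\<close>, up to a constant. Since truncation makes \<open>I\<close> finite, \<open>I\<close> can be absorbed. The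
  bound does not depend on the truncation height. This replaces the exponential integrability of
  \<open>g\<close> (John--Nirenberg) and the boundedness of the maximal operator on \<open>L\<^sup>2\<close>.
\<close>

lemma nn_avg_truncated_locmax_le:
  fixes N :: nat
  assumes "0 < R0"
  shows "nn_avg \<mu> (ball z R0) (\<lambda>x. min (locmax z R0 x) (of_nat N)) \<le> ennreal (3 * A\<^sup>2 * stop_level)"
proof -
  define T where "T z r x = min (locmax z r x) (of_nat N)" for z r x
  define I where "I = (SUP p\<in>balls. nn_avg \<mu> (ball (fst p) (snd p)) (T (fst p) (snd p)))"
  define c where "c = A\<^sup>2 * stop_level"
  have c: "0 < c" "stop_level \<le> c"
    unfolding c_def using stop_level_pos stop_level_le by linarith+
  have T_meas [measurable]: "T z r \<in> borel_measurable \<mu>" for z r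
    unfolding T_def by measurable
  have T_int: "(\<integral>\<^sup>+x\<in>ball z r. T z r x \<partial>\<mu>) \<le> I * emeasure \<mu> (ball z r)" if "0 < r" for z r
    unfolding nn_avg_le_iff[OF that, symmetric] I_def
    by (rule SUP_upper2[of "(z, r)"]) (auto simp: balls_def that)
  have "I \<le> of_nat N"
    unfolding I_def
  proof (rule SUP_least)
    fix p :: "'a \<times> real" assume "p \<in> balls"
    then have r: "0 < snd p" by (auto simp: balls_def)
    show "nn_avg \<mu> (ball (fst p) (snd p)) (T (fst p) (snd p)) \<le> of_nat N"
      unfolding nn_avg_le_iff[OF r]
      by (subst nn_integral_cmult_indicator[symmetric])
        (auto intro!: nn_integral_mono mult_right_mono simp: T_def)
  qed
  have step: "(\<integral>\<^sup>+x\<in>ball z0 R. T z0 R x \<partial>\<mu>)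
      \<le> (ennreal stop_level + (I + ennreal c) * ennreal (1 / 2)) * emeasure \<mu> (ball z0 R)"
    if R: "0 < R" for z0 R
  proof -
    from stopping_balls[OF R, of z0, folded c_def] obtain J :: "'a set" and w r
      where J: "countable J" "\<forall>j\<in>J. 0 < r j"
      and small: "(\<integral>\<^sup>+j. emeasure \<mu> (ball (w j) (r j)) \<partial>count_space J)
        \<le> ennreal (1 / 2) * emeasure \<mu> (ball z0 R)"
      and dom: "\<forall>x\<in>ball z0 R. locmax z0 R x \<le> stop_level \<or>
        (\<exists>j\<in>J. x \<in> ball (w j) (r j) \<and> locmax z0 R x \<le> locmax (w j) (r j) x + ennreal c)"
      by (elim exE conjE)
    define q where "q j x = (T (w j) (r j) x + ennreal c) * indicator (ball (w j) (r j)) x" for j x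
    have q_meas [measurable]: "q j \<in> borel_measurable \<mu>" for j
      unfolding q_def by measurable
    have q_int: "(\<integral>\<^sup>+x. q j x \<partial>\<mu>) \<le> (I + ennreal c) * emeasure \<mu> (ball (w j) (r j))" if "j \<in> J" for j
    proof -
      have "(\<integral>\<^sup>+x. q j x \<partial>\<mu>) = (\<integral>\<^sup>+x\<in>ball (w j) (r j). T (w j) (r j) x \<partial>\<mu>)
          + ennreal c * emeasure \<mu> (ball (w j) (r j))"
        unfolding q_def distrib_right
        by (subst nn_integral_add) (auto simp: nn_integral_cmult_indicator)
      also have "\<dots> \<le> (I + ennreal c) * emeasure \<mu> (ball (w j) (r j))"
        unfolding distrib_right using J(2) that by (intro add_right_mono T_int) blast
      finally show ?thesis .
    qed
    \<comment> \<open>Truncation is subadditive in the sense needed here: \<open>min (a + c) N \<le> min a N + c\<close>.\<close>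
    have "T z0 R x * indicator (ball z0 R) x
        \<le> ennreal stop_level * indicator (ball z0 R) x + (\<integral>\<^sup>+j. q j x \<partial>count_space J)" for x
    proof (cases "x \<in> ball z0 R \<and> \<not> locmax z0 R x \<le> stop_level")
      case True
      then obtain j where j: "j \<in> J" "x \<in> ball (w j) (r j)"
        "locmax z0 R x \<le> locmax (w j) (r j) x + ennreal c" using dom by auto
      have "T z0 R x \<le> T (w j) (r j) x + ennreal c"
      proof (cases "locmax (w j) (r j) x \<le> of_nat N")
        case True
        have "T z0 R x \<le> locmax z0 R x" unfolding T_def by (rule min.cobounded1)
        also note j(3)
        also have "locmax (w j) (r j) x = T (w j) (r j) x"
          unfolding T_def using True by (rule min_absorb1[symmetric])
        finally show ?thesis .
      next
        case False
        have "T z0 R x \<le> of_nat N" unfolding T_def by (rule min.cobounded2)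
        also have "of_nat N = T (w j) (r j) x"
          unfolding T_def using False by (intro min_absorb2[symmetric]) simp
        also have "\<dots> \<le> T (w j) (r j) x + ennreal c"
          by simp
        finally show ?thesis .
      qed
      also have "\<dots> = q j x"
        using j(2) unfolding q_def by simp
      also have "\<dots> \<le> (\<integral>\<^sup>+j. q j x \<partial>count_space J)"
        using j(1) by (rule nn_integral_ge_point)
      finally show ?thesis using True by (simp add: add_increasing)
    next
      case False
      then show ?thesis
        by (auto simp: T_def indicator_def intro!: add_increasing2 intro: min.coboundedI1)
    qed
    then have "(\<integral>\<^sup>+x\<in>ball z0 R. T z0 R x \<partial>\<mu>)
        \<le> (\<integral>\<^sup>+x. ennreal stop_level * indicator (ball z0 R) x + (\<integral>\<^sup>+j. q j x \<partial>count_space J) \<partial>\<mu>)"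
      by (rule nn_integral_mono)
    also have "\<dots> = ennreal stop_level * emeasure \<mu> (ball z0 R) + (\<integral>\<^sup>+x. \<integral>\<^sup>+j. q j x \<partial>count_space J \<partial>\<mu>)"
      using J(1) by (subst nn_integral_add) (auto simp: nn_integral_cmult_indicator
        intro!: measurable_nn_integral_count_space)
    also have "(\<integral>\<^sup>+x. \<integral>\<^sup>+j. q j x \<partial>count_space J \<partial>\<mu>) = (\<integral>\<^sup>+j. \<integral>\<^sup>+x. q j x \<partial>\<mu> \<partial>count_space J)"
      using J(1) by (rule nn_integral_count_space_nn_integral) simp
    also have "\<dots> \<le> (\<integral>\<^sup>+j. (I + ennreal c) * emeasure \<mu> (ball (w j) (r j)) \<partial>count_space J)"
      using q_int by (intro nn_integral_mono) auto
    also have "\<dots> = (I + ennreal c) * (\<integral>\<^sup>+j. emeasure \<mu> (ball (w j) (r j)) \<partial>count_space J)"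
      by (rule nn_integral_cmult) auto
    also have "\<dots> \<le> (I + ennreal c) * (ennreal (1 / 2) * emeasure \<mu> (ball z0 R))"
      using small by (rule mult_left_mono) simp
    finally show ?thesis
      by (simp add: distrib_right mult.assoc add_left_mono)
  qed
  have "I \<le> ennreal stop_level + (I + ennreal c) * ennreal (1 / 2)"
  proof (subst (1) I_def, rule SUP_least)
    fix p :: "'a \<times> real" assume "p \<in> balls"
    then have r: "0 < snd p" by (auto simp: balls_def)
    show "nn_avg \<mu> (ball (fst p) (snd p)) (T (fst p) (snd p))
        \<le> ennreal stop_level + (I + ennreal c) * ennreal (1 / 2)"
      unfolding nn_avg_le_iff[OF r] by (rule step[OF r])
  qed
  moreover obtain i where i: "I = ennreal i" "0 \<le> i"
    using \<open>I \<le> of_nat N\<close> by (cases I) (auto simp: top_unique)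
  moreover have "ennreal stop_level + (ennreal i + ennreal c) * ennreal (1 / 2)
      = ennreal (stop_level + (i + c) * (1 / 2))"
  proof -
    have "ennreal (stop_level + (i + c) * (1 / 2)) = ennreal stop_level + ennreal ((i + c) * (1 / 2))"
      using c stop_level_pos i(2) by (intro ennreal_plus) auto
    also have "ennreal ((i + c) * (1 / 2)) = ennreal (i + c) * ennreal (1 / 2)"
      using c i(2) by (intro ennreal_mult) auto
    also have "ennreal (i + c) = ennreal i + ennreal c"
      using c i(2) by (intro ennreal_plus) auto
    finally show ?thesis ..
  qed
  ultimately have "ennreal i \<le> ennreal (stop_level + (i + c) * (1 / 2))"
    by metis
  then have "i \<le> stop_level + (i + c) * (1 / 2)"
    by (rule iffD1[OF ennreal_le_iff, rotated]) (use c stop_level_pos i(2) in simp)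
  then have "2 * i \<le> 2 * stop_level + i + c" by (simp add: field_simps)
  with c have "i \<le> 3 * c" by linarith
  then have "I \<le> ennreal (3 * A\<^sup>2 * stop_level)"
    unfolding i c_def by (intro ennreal_leI) simp
  moreover have "nn_avg \<mu> (ball z R0) (T z R0) \<le> I"
    unfolding I_def using assms by (intro SUP_upper2[of "(z, R0)"]) (auto simp: balls_def)
  ultimately show ?thesis
    unfolding T_def by (rule order_trans[rotated])
qed

lemma nn_integral_locmax_le:
  assumes "0 < R"
  shows "(\<integral>\<^sup>+x\<in>ball z R. locmax z R x \<partial>\<mu>) \<le> ennreal (12 * A ^ 12 * K) * emeasure \<mu> (ball z R)"
proof -
  have eq: "locmax z R x * indicator (ball z R) x
      = (SUP N. min (locmax z R x) (of_nat N) * indicator (ball z R) x)" for x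
  proof -
    have "(SUP N. min (locmax z R x) (of_nat N)) = min (locmax z R x) (SUP N. of_nat N)"
      using inf_SUP[of "locmax z R x" "of_nat :: nat \<Rightarrow> ennreal" UNIV]
      by (simp add: inf_min)
    then show ?thesis
      by (simp add: ennreal_SUP_of_nat_eq_top SUP_mult_right_ennreal[symmetric])
  qed
  have "(\<integral>\<^sup>+x\<in>ball z R. locmax z R x \<partial>\<mu>)
      = (SUP N. \<integral>\<^sup>+x\<in>ball z R. min (locmax z R x) (of_nat N) \<partial>\<mu>)"
    unfolding eq
    by (rule nn_integral_monotone_convergence_SUP)
      (auto simp: incseq_def le_fun_def intro!: mult_right_mono min.mono)
  also have "\<dots> \<le> ennreal (3 * A\<^sup>2 * stop_level) * emeasure \<mu> (ball z R)"
    using nn_avg_truncated_locmax_le[OF assms] unfolding nn_avg_le_iff[OF assms]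
    by (intro SUP_least)
  also have "3 * A\<^sup>2 * stop_level = 12 * A ^ 12 * K"
    unfolding stop_level_def by (simp add: power_add[symmetric] field_simps)
  finally show ?thesis .
qed

end

section \<open>Maximal functions over families of balls\<close>

definition max_over :: "'a::metric_space measure \<Rightarrow> ('a \<times> real) set \<Rightarrow> ('a \<Rightarrow> real) \<Rightarrow> 'a \<Rightarrow> ereal" where
  "max_over \<mu> P g x = (SUP p\<in>{p\<in>P. x \<in> ball (fst p) (snd p)}. ereal (avg \<mu> (ball (fst p) (snd p)) g))"

lemma avg_le_max_over:
  "(z, s) \<in> P \<Longrightarrow> x \<in> ball z s \<Longrightarrow> ereal (avg \<mu> (ball z s) g) \<le> max_over \<mu> P g x"
  unfolding max_over_def by (rule SUP_upper2[of "(z, s)"]) auto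

lemma max_over_leI:
  "(\<And>z s. (z, s) \<in> P \<Longrightarrow> x \<in> ball z s \<Longrightarrow> ereal (avg \<mu> (ball z s) g) \<le> c) \<Longrightarrow> max_over \<mu> P g x \<le> c"
  unfolding max_over_def by (rule SUP_least) auto

lemma (in doubling_space) max_over_measurable [measurable]: "max_over \<mu> P g \<in> borel_measurable \<mu>"
  unfolding max_over_def[abs_def] by (rule measurable_SUP_balls)

context mean_oscillation
begin

lemma nn_integral_const_add_locmax_le:
  assumes "0 < R" "0 \<le> D"
  shows "(\<integral>\<^sup>+x\<in>ball z R. (ennreal D + locmax z R x) \<partial>\<mu>)
    \<le> ennreal (D + 12 * A ^ 12 * K) * emeasure \<mu> (ball z R)"
proof -
  have "(\<integral>\<^sup>+x\<in>ball z R. (ennreal D + locmax z R x) \<partial>\<mu>)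
      = ennreal D * emeasure \<mu> (ball z R) + (\<integral>\<^sup>+x\<in>ball z R. locmax z R x \<partial>\<mu>)"
    unfolding distrib_right by (subst nn_integral_add) (auto simp: nn_integral_cmult_indicator)
  also have "\<dots> \<le> ennreal D * emeasure \<mu> (ball z R)
      + ennreal (12 * A ^ 12 * K) * emeasure \<mu> (ball z R)"
    using nn_integral_locmax_le[OF assms(1)] by (rule add_left_mono)
  also have "\<dots> = ennreal (D + 12 * A ^ 12 * K) * emeasure \<mu> (ball z R)"
    using assms(2) A_ge_1 K_pos by (subst ennreal_plus) (auto simp: distrib_right)
  finally show ?thesis .
qed

text \<open>
  The pointwise comparison behind the bound for the lower oscillation. A ball through \<open>x\<close> of
  radius at most \<open>R\<close> has an average within \<open>locmax z0 R x\<close> of the average over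
  \<open>ball z0 R\<close>, and the latter ball is among those seen from \<open>y\<close>. The threefold dilate of
  a ball through \<open>x\<close> of larger radius contains \<open>y\<close>, and hypothesis \<open>far\<close> then bounds
  the average over the original ball by the maximal function at \<open>y\<close>.
\<close>

lemma max_over_le_max_over:
  assumes "0 < R" "(z0, R) \<in> P" "P \<subseteq> balls" "0 \<le> D"
    and far: "\<And>z s. (z, s) \<in> P \<Longrightarrow> y \<in> ball z (3 * s) \<Longrightarrow>
      ereal (avg \<mu> (ball z s) g) \<le> max_over \<mu> P g y + ereal D"
    and xy: "x \<in> ball z0 R" "y \<in> ball z0 R"
    and l: "locmax z0 R x = ennreal l" "0 \<le> l"
  shows "max_over \<mu> P g x \<le> max_over \<mu> P g y + ereal (D + l)"
proof (rule max_over_leI)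
  fix z s assume zs: "(z, s) \<in> P" "x \<in> ball z s"
  then have "0 < s" using assms(3) unfolding balls_def by auto
  show "ereal (avg \<mu> (ball z s) g) \<le> max_over \<mu> P g y + ereal (D + l)"
  proof (cases "s \<le> R")
    case True
    have "ennreal (dev z0 R z s) \<le> ennreal l"
      using dev_le_locmax[OF \<open>0 < s\<close> True zs(2), of z0] l(1) by simp
    then have "dev z0 R z s \<le> l"
      using l(2) by (simp add: ennreal_le_iff)
    with avg_diff_le_dev[OF \<open>0 < s\<close>, of z z0 R] assms(4)
    have "avg \<mu> (ball z s) g \<le> avg \<mu> (ball z0 R) g + (D + l)"
      by linarith
    then have "ereal (avg \<mu> (ball z s) g) \<le> ereal (avg \<mu> (ball z0 R) g) + ereal (D + l)"
      by simp
    also have "\<dots> \<le> max_over \<mu> P g y + ereal (D + l)"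
      using assms(2) xy(2) by (intro add_right_mono avg_le_max_over) auto
    finally show ?thesis .
  next
    case False
    have "dist z y < 3 * s"
      using dist_triangle[of z y x] dist_triangle[of x y z0] zs(2) xy False
      by (simp add: dist_commute)
    then have "ereal (avg \<mu> (ball z s) g) \<le> max_over \<mu> P g y + ereal D"
      using far[OF zs(1)] by simp
    also have "\<dots> \<le> max_over \<mu> P g y + ereal (D + l)"
      using l(2) by (intro add_left_mono) simp
    finally show ?thesis .
  qed
qed

text \<open>
  The pointwise comparison holds for almost every \<open>y\<close> in the ball, so \<open>y\<close> can be
  replaced by the essential infimum; integration in \<open>x\<close> then only involves the local maximal
  function.
\<close>

lemma nn_avg_max_over_minus_ess_inf_le:
  fixes G :: "'a \<Rightarrow> real" and P
  defines "G \<equiv> real_of_ereal \<circ> max_over \<mu> P g"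
  assumes R: "0 < R" and P: "(z0, R) \<in> P" "P \<subseteq> balls" and D: "0 \<le> D"
    and fin: "AE x in \<mu>. \<bar>max_over \<mu> P g x\<bar> \<noteq> \<infinity>"
    and far: "\<And>z s y. (z, s) \<in> P \<Longrightarrow> y \<in> ball z (3 * s) \<Longrightarrow>
      ereal (avg \<mu> (ball z s) g) \<le> max_over \<mu> P g y + ereal D"
  shows "nn_avg \<mu> (ball z0 R) (\<lambda>y. e2ennreal (ereal (G y) - ess_inf \<mu> (ball z0 R) G))
    \<le> ennreal (D + 12 * A ^ 12 * K)"
proof -
  let ?B = "ball z0 R"
  have "e2ennreal (ereal (G x) - ess_inf \<mu> ?B G) \<le> ennreal D + locmax z0 R x"
    if x: "x \<in> ?B" "\<bar>max_over \<mu> P g x\<bar> \<noteq> \<infinity>" for x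
  proof (cases "locmax z0 R x")
    case (real l)
    have "AE y \<in> ?B in \<mu>. ereal (G x - (D + l)) \<le> ereal (G y)"
      using fin
    proof eventually_elim
      case (elim y)
      show ?case
      proof
        assume "y \<in> ?B"
        with max_over_le_max_over[OF R P D far x(1) _ real(2,1)]
        have "max_over \<mu> P g x \<le> max_over \<mu> P g y + ereal (D + l)" by blast
        then show "ereal (G x - (D + l)) \<le> ereal (G y)"
          using elim x(2) unfolding G_def
          by (cases "max_over \<mu> P g x"; cases "max_over \<mu> P g y") auto
      qed
    qed
    then have "ereal (G x - (D + l)) \<le> ess_inf \<mu> ?B G"
      unfolding ess_inf_def by (intro Sup_upper) simp
    then have "ereal (G x) - ess_inf \<mu> ?B G \<le> ereal (G x) - ereal (G x - (D + l))"
      by (intro ereal_minus_mono) auto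
    also have "\<dots> = ereal (D + l)" by simp
    finally have "e2ennreal (ereal (G x) - ess_inf \<mu> ?B G) \<le> e2ennreal (ereal (D + l))"
      by (rule e2ennreal_mono)
    then show ?thesis
      using real D by (simp add: ennreal.abs_eq[symmetric] ennreal_plus)
  qed simp
  note pointwise = this
  have "AE x in \<mu>. e2ennreal (ereal (G x) - ess_inf \<mu> ?B G) * indicator ?B x
      \<le> (ennreal D + locmax z0 R x) * indicator ?B x"
    using fin by eventually_elim (use pointwise in \<open>auto simp: indicator_def\<close>)
  then have "(\<integral>\<^sup>+x\<in>?B. e2ennreal (ereal (G x) - ess_inf \<mu> ?B G) \<partial>\<mu>)
      \<le> (\<integral>\<^sup>+x\<in>?B. (ennreal D + locmax z0 R x) \<partial>\<mu>)"
    by (rule nn_integral_mono_AE)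
  also have "\<dots> \<le> ennreal (D + 12 * A ^ 12 * K) * emeasure \<mu> ?B"
    by (rule nn_integral_const_add_locmax_le[OF R D])
  finally show ?thesis
    unfolding nn_avg_le_iff[OF R] .
qed

text \<open>
  Same splitting by the radius, but now all averages are bounded in absolute value, either directly
  (large radius) or by the average over the ball itself plus the local maximal function (small
  radius). The integrand may be infinite here, since finiteness almost everywhere is to be
  deduced from this bound.
\<close>

lemma nn_integral_abs_max_over_le:
  assumes R: "0 < R" and P: "P \<subseteq> balls" and D: "0 \<le> D"
    and ex: "\<And>x. \<exists>z s. (z, s) \<in> P \<and> x \<in> ball z s"
    and near: "\<bar>avg \<mu> (ball z0 R) g\<bar> \<le> D"
    and far: "\<And>z s x. (z, s) \<in> P \<Longrightarrow> R < s \<Longrightarrow> x \<in> ball z s \<Longrightarrow> x \<in> ball z0 R \<Longrightarrow>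
      \<bar>avg \<mu> (ball z s) g\<bar> \<le> D"
  shows "(\<integral>\<^sup>+x\<in>ball z0 R. e2ennreal \<bar>max_over \<mu> P g x\<bar> \<partial>\<mu>)
    \<le> ennreal (D + 12 * A ^ 12 * K) * emeasure \<mu> (ball z0 R)"
proof -
  have "e2ennreal \<bar>max_over \<mu> P g x\<bar> \<le> ennreal D + locmax z0 R x" if x: "x \<in> ball z0 R" for x
  proof (cases "locmax z0 R x")
    case (real l)
    have bound: "\<bar>avg \<mu> (ball z s) g\<bar> \<le> D + l" if zs: "(z, s) \<in> P" "x \<in> ball z s" for z s
    proof (cases "s \<le> R")
      case True
      have "0 < s" using zs P unfolding balls_def by auto
      have "ennreal (dev z0 R z s) \<le> ennreal l"
        using dev_le_locmax[OF \<open>0 < s\<close> True zs(2), of z0] real by simp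
      then have "dev z0 R z s \<le> l"
        using real by (simp add: ennreal_le_iff)
      with avg_diff_le_dev[OF \<open>0 < s\<close>, of z z0 R] near show ?thesis by linarith
    next
      case False
      with far[OF zs(1) _ zs(2) x] real show ?thesis by linarith
    qed
    obtain z s where zs: "(z, s) \<in> P" "x \<in> ball z s" using ex by blast
    have "ereal (- (D + l)) \<le> ereal (avg \<mu> (ball z s) g)"
      using bound[OF zs] by simp
    also have "\<dots> \<le> max_over \<mu> P g x"
      using zs by (rule avg_le_max_over)
    finally have "ereal (- (D + l)) \<le> max_over \<mu> P g x" .
    moreover have "max_over \<mu> P g x \<le> ereal (D + l)"
      using bound by (intro max_over_leI) (simp add: abs_le_iff)
    ultimately have "\<bar>max_over \<mu> P g x\<bar> \<le> ereal (D + l)"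
      by (cases "max_over \<mu> P g x") auto
    then have "e2ennreal \<bar>max_over \<mu> P g x\<bar> \<le> e2ennreal (ereal (D + l))"
      by (rule e2ennreal_mono)
    then show ?thesis
      using real D by (simp add: ennreal.abs_eq[symmetric] ennreal_plus)
  qed simp
  then have "(\<integral>\<^sup>+x\<in>ball z0 R. e2ennreal \<bar>max_over \<mu> P g x\<bar> \<partial>\<mu>)
      \<le> (\<integral>\<^sup>+x\<in>ball z0 R. (ennreal D + locmax z0 R x) \<partial>\<mu>)"
    by (intro nn_integral_mono) (auto simp: indicator_def)
  also have "\<dots> \<le> ennreal (D + 12 * A ^ 12 * K) * emeasure \<mu> (ball z0 R)"
    by (rule nn_integral_const_add_locmax_le[OF R D])
  finally show ?thesis .
qed

text \<open>
  A large ball stays large when dilated about its own center, and a ball of even larger radius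
  which meets it lies in such a dilate. Therefore the hypothesis \<open>large\<close>, on balls in
  \<open>large_balls \<rho>\<close>, yields the size bounds. As the space is a countable union of large balls,
  these also give finiteness almost everywhere and local integrability.
\<close>

lemma BLO_max_over:
  fixes \<rho> :: "'a \<Rightarrow> real"
  assumes \<rho>: "\<And>x. 0 < \<rho> x" and P: "P \<subseteq> balls" "balls - large_balls \<rho> \<subseteq> P" and D: "0 \<le> D"
    and far: "\<And>z s y. (z, s) \<in> P \<Longrightarrow> y \<in> ball z (3 * s) \<Longrightarrow>
      ereal (avg \<mu> (ball z s) g) \<le> max_over \<mu> P g y + ereal D"
    and large: "\<And>z R. \<rho> z \<le> R \<Longrightarrow> avg \<mu> (ball z R) (\<lambda>y. \<bar>g y\<bar>) \<le> D"
  shows "in_BLO_ext \<mu> \<rho> (max_over \<mu> P g)"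
    and "BLO_norm \<mu> \<rho> (real_of_ereal \<circ> max_over \<mu> P g) \<le> ennreal (2 * (A ^ 3 * D + 12 * A ^ 12 * K))"
proof -
  let ?M = "max_over \<mu> P g"
  let ?G = "real_of_ereal \<circ> max_over \<mu> P g"
  let ?c = "A ^ 3 * D + 12 * A ^ 12 * K"
  have D': "D \<le> A ^ 3 * D"
    using mult_right_mono[OF one_le_power[OF A_ge_1, of 3] D] by simp
  have c: "0 \<le> ?c"
    using D A_ge_1 K_pos by simp
  have abs_loc: "(\<lambda>y. \<bar>g y\<bar>) \<in> L1_loc \<mu>"
    using L1_loc_dev[OF g_loc, of 0] by simp
  have ex: "\<exists>z s. (z, s) \<in> P \<and> x \<in> ball z s" for x
    using P(2) \<rho>[of x] unfolding balls_def large_balls_def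
    by (intro exI[of _ x] exI[of _ "\<rho> x / 2"]) auto
  have int: "(\<integral>\<^sup>+x\<in>ball z R. e2ennreal \<bar>?M x\<bar> \<partial>\<mu>) \<le> ennreal ?c * emeasure \<mu> (ball z R)"
    if R: "\<rho> z \<le> R" for z R
  proof (rule nn_integral_abs_max_over_le[OF _ P(1) _ ex])
    show "0 < R" using R \<rho>[of z] by linarith
    show "0 \<le> A ^ 3 * D" using D A_ge_1 by simp
    show "\<bar>avg \<mu> (ball z R) g\<bar> \<le> A ^ 3 * D"
      using abs_avg_le[OF g_loc \<open>0 < R\<close>, of z] large[OF R] D' by linarith
    fix w s x assume s: "(w, s) \<in> P" "R < s" "x \<in> ball w s" "x \<in> ball z R"
    have "dist w z < s + R"
      using s(3,4) dist_triangle[of w z x] by (simp add: dist_commute)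
    then have "avg \<mu> (ball w s) (\<lambda>y. \<bar>g y\<bar>) \<le> A ^ 3 * avg \<mu> (ball z (3 * s)) (\<lambda>y. \<bar>g y\<bar>)"
      using s(2) \<open>0 < R\<close> abs_loc by (intro avg_le_larger_ball) (auto simp: dist_commute)
    also have "\<dots> \<le> A ^ 3 * D"
      using large[of z "3 * s"] s(2) R \<open>0 < R\<close> A_ge_1 by (intro mult_left_mono) auto
    finally show "\<bar>avg \<mu> (ball w s) g\<bar> \<le> A ^ 3 * D"
      using abs_avg_le[OF g_loc, of s w] s(2) \<open>0 < R\<close> by simp
  qed
  have fin: "AE x in \<mu>. \<bar>?M x\<bar> \<noteq> \<infinity>"
  proof -
    fix z :: 'a
    have "AE x in \<mu>. \<forall>n::nat. x \<in> ball z (\<rho> z + n) \<longrightarrow> \<bar>?M x\<bar> \<noteq> \<infinity>"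
    proof (subst AE_all_countable, rule allI)
      fix n :: nat
      have "(\<integral>\<^sup>+x\<in>ball z (\<rho> z + n). e2ennreal \<bar>?M x\<bar> \<partial>\<mu>)
          \<le> ennreal ?c * emeasure \<mu> (ball z (\<rho> z + n))"
        by (intro int) simp
      also have "\<dots> < \<infinity>"
        using ball_finite[of "\<rho> z + n" z] \<rho>[of z] by (simp add: ennreal_mult_less_top add_pos_nonneg)
      finally have "AE x in \<mu>. e2ennreal \<bar>?M x\<bar> * indicator (ball z (\<rho> z + n)) x \<noteq> \<infinity>"
        by (intro nn_integral_PInf_AE) auto
      then show "AE x in \<mu>. x \<in> ball z (\<rho> z + n) \<longrightarrow> \<bar>?M x\<bar> \<noteq> \<infinity>"
      proof eventually_elim
        case (elim x)
        then show ?case by (cases "?M x") auto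
      qed
    qed
    then show ?thesis
    proof eventually_elim
      case (elim x)
      obtain n :: nat where "dist z x < n" using reals_Archimedean2 by blast
      with elim[rule_format, of n] \<rho>[of z] show ?case by simp
    qed
  qed
  have abs_le: "ennreal \<bar>?G x\<bar> \<le> e2ennreal \<bar>?M x\<bar>" for x
    by (cases "?M x") (auto simp: ennreal.abs_eq[symmetric])
  have int': "(\<integral>\<^sup>+x\<in>ball z R. ennreal \<bar>?G x\<bar> \<partial>\<mu>) \<le> ennreal ?c * emeasure \<mu> (ball z R)"
    if "\<rho> z \<le> R" for z R
    by (rule order_trans[OF nn_integral_mono int[OF that]]) (intro mult_right_mono abs_le, simp)
  have loc: "?G \<in> L1_loc \<mu>"
    unfolding L1_loc_def
  proof safe
    fix z :: 'a and r :: real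
    define R where "R = max r (\<rho> z)"
    have R: "0 < R" "\<rho> z \<le> R" "ball z r \<subseteq> ball z R"
      unfolding R_def using \<rho>[of z] by (auto simp: less_max_iff_disj)
    have "(\<integral>\<^sup>+x. ennreal (norm (indicator (ball z r) x *\<^sub>R ?G x)) \<partial>\<mu>)
        \<le> (\<integral>\<^sup>+x\<in>ball z R. ennreal \<bar>?G x\<bar> \<partial>\<mu>)"
      using R(3) by (intro nn_integral_mono) (auto simp: indicator_def)
    also have "\<dots> \<le> ennreal ?c * emeasure \<mu> (ball z R)"
      by (rule int'[OF R(2)])
    also have "\<dots> < \<infinity>"
      using ball_finite[OF R(1), of z] by (simp add: ennreal_mult_less_top)
    finally show "set_integrable \<mu> (ball z r) ?G"
      unfolding set_integrable_def by (intro integrableI_bounded) auto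
  qed
  have "BLO_norm \<mu> \<rho> ?G \<le> ennreal ?c + ennreal ?c"
    unfolding BLO_norm_def
  proof (intro add_mono SUP_least; clarify)
    fix z r assume zr: "(z, r) \<in> balls" "(z, r) \<notin> large_balls \<rho>"
    then have r: "0 < r" unfolding balls_def by auto
    have "nn_avg \<mu> (ball z r) (\<lambda>y. e2ennreal (ereal (?G y) - ess_inf \<mu> (ball z r) ?G))
        \<le> ennreal (D + 12 * A ^ 12 * K)"
      using zr P(2) by (intro nn_avg_max_over_minus_ess_inf_le[OF r _ P(1) D fin far]) auto
    also have "\<dots> \<le> ennreal ?c"
      using D' by (intro ennreal_leI) simp
    finally show "nn_avg \<mu> (ball z r) (\<lambda>y. e2ennreal (ereal (?G y) - ess_inf \<mu> (ball z r) ?G))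
        \<le> ennreal ?c" .
  next
    fix z r assume "(z, r) \<in> large_balls \<rho>"
    then have r: "0 < r" "\<rho> z \<le> r" unfolding large_balls_def balls_def by auto
    show "nn_avg \<mu> (ball z r) (\<lambda>y. ennreal \<bar>?G y\<bar>) \<le> ennreal ?c"
      unfolding nn_avg_le_iff[OF r(1)] by (rule int'[OF r(2)])
  qed
  also have "\<dots> = ennreal (2 * ?c)"
    by (subst mult_2, rule ennreal_plus[symmetric]) (fact c)+
  finally show norm: "BLO_norm \<mu> \<rho> ?G \<le> ennreal (2 * ?c)" .
  then show "in_BLO_ext \<mu> \<rho> ?M"
    unfolding in_BLO_ext_def BLO_def using fin loc by (auto simp: less_top[symmetric] top_unique intro: le_less_trans)
qed

end

section \<open>Boundedness of the maximal operators\<close>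

lemma HL_eq_max_over: "HL \<mu> f = max_over \<mu> balls (\<lambda>y. \<bar>f y\<bar>)"
  unfolding HL_def max_over_def case_prod_unfold fun_eq_iff
  by (intro allI SUP_cong) auto

lemma max_avg_eq_max_over: "max_avg \<mu> f = max_over \<mu> balls f"
  unfolding max_avg_def max_over_def case_prod_unfold fun_eq_iff
  by (intro allI SUP_cong) auto

lemma HL_loc_eq_max_over: "HL_loc \<mu> \<rho> f = max_over \<mu> (balls - large_balls \<rho>) (\<lambda>y. \<bar>f y\<bar>)"
  unfolding HL_loc_def max_over_def case_prod_unfold fun_eq_iff
  by (intro allI SUP_cong) auto

context doubling_space
begin

lemma avg_abs_le_if_BMO_norm_le:
  assumes f: "f \<in> L1_loc \<mu>" and K: "0 < K" "BMO_norm \<mu> \<rho> f \<le> ennreal K"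
    and r: "0 < r" "\<rho> z \<le> r"
  shows "avg \<mu> (ball z r) (\<lambda>y. \<bar>f y\<bar>) \<le> K"
proof -
  have "ennreal (avg \<mu> (ball z r) (\<lambda>y. \<bar>f y\<bar>)) = nn_avg \<mu> (ball z r) (\<lambda>y. ennreal \<bar>f y\<bar>)"
    using L1_loc_dev[OF f, of 0] r(1) by (intro nn_avg_eq_avg[symmetric]) auto
  also have "\<dots> \<le> (SUP (z, r) \<in> large_balls \<rho>. nn_avg \<mu> (ball z r) (\<lambda>y. ennreal \<bar>f y\<bar>))"
    using r by (intro SUP_upper2[of "(z, r)"]) (auto simp: large_balls_def balls_def)
  also have "\<dots> \<le> BMO_norm \<mu> \<rho> f"
    unfolding BMO_norm_def by (simp add: add_increasing)
  also note K(2)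
  finally show ?thesis
    using K(1) by (simp add: ennreal_le_iff)
qed

lemma avg_dev_le_if_BMO_norm_le:
  assumes f: "f \<in> L1_loc \<mu>" and K: "0 < K" "BMO_norm \<mu> \<rho> f \<le> ennreal K" and r: "0 < r"
  shows "avg \<mu> (ball z r) (\<lambda>y. \<bar>f y - avg \<mu> (ball z r) f\<bar>) \<le> 2 * K"
proof (cases "\<rho> z \<le> r")
  case True
  have "avg \<mu> (ball z r) (\<lambda>y. \<bar>f y - avg \<mu> (ball z r) f\<bar>)
      \<le> avg \<mu> (ball z r) (\<lambda>y. \<bar>f y - 0\<bar>) + \<bar>0 - avg \<mu> (ball z r) f\<bar>"
    using f r by (rule avg_dev_change_center)
  then show ?thesis
    using abs_avg_le[OF f r, of z] avg_abs_le_if_BMO_norm_le[OF f K r True] by simp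
next
  case False
  let ?d = "\<lambda>z r y. \<bar>f y - avg \<mu> (ball z r) f\<bar>"
  have "ennreal (avg \<mu> (ball z r) (?d z r)) = nn_avg \<mu> (ball z r) (\<lambda>y. ennreal (?d z r y))"
    using L1_loc_dev[OF f] r by (intro nn_avg_eq_avg[symmetric]) auto
  also have "\<dots> \<le> (SUP (z, r) \<in> balls - large_balls \<rho>. nn_avg \<mu> (ball z r) (\<lambda>y. ennreal (?d z r y)))"
    using r False by (intro SUP_upper2[of "(z, r)"]) (auto simp: large_balls_def balls_def)
  also have "\<dots> \<le> BMO_norm \<mu> \<rho> f"
    unfolding BMO_norm_def by (simp add: add_increasing2)
  also note K(2)
  finally show ?thesis
    using K(1) by (simp add: ennreal_le_iff)
qed

text \<open>
  Taking absolute values is a contraction, and changing the center of the deviation costs a factor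
  \<open>2\<close>. This reduces the maximal functions of \<open>f\<close> with absolute values to maximal functions of
  the oscillating function \<open>\<lambda>y. \<bar>f y\<bar>\<close>.
\<close>

lemma avg_dev_abs_le:
  assumes f: "f \<in> L1_loc \<mu>" and r: "0 < r"
  shows "avg \<mu> (ball z r) (\<lambda>y. \<bar>\<bar>f y\<bar> - avg \<mu> (ball z r) (\<lambda>y. \<bar>f y\<bar>)\<bar>)
    \<le> 2 * avg \<mu> (ball z r) (\<lambda>y. \<bar>f y - avg \<mu> (ball z r) f\<bar>)"
proof -
  let ?m = "avg \<mu> (ball z r) f" and ?B = "ball z r"
  have abs_f: "(\<lambda>y. \<bar>f y\<bar>) \<in> L1_loc \<mu>"
    using L1_loc_dev[OF f, of 0] by simp
  have "avg \<mu> ?B (\<lambda>y. \<bar>\<bar>f y\<bar> - \<bar>?m\<bar>\<bar>) \<le> avg \<mu> ?B (\<lambda>y. \<bar>f y - ?m\<bar>)"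
    using f abs_f r by (intro avg_mono L1_loc_dev) auto
  moreover have "\<bar>avg \<mu> ?B (\<lambda>y. \<bar>f y\<bar>) - \<bar>?m\<bar>\<bar> \<le> avg \<mu> ?B (\<lambda>y. \<bar>\<bar>f y\<bar> - \<bar>?m\<bar>\<bar>)"
    using abs_f r by (rule abs_avg_minus_le)
  ultimately show ?thesis
    using avg_dev_change_center[OF abs_f r, of z "avg \<mu> ?B (\<lambda>y. \<bar>f y\<bar>)" "\<bar>?m\<bar>"] by linarith
qed

text \<open>
  What remains is hypothesis \<open>far\<close> of \<open>BLO_max_over\<close> for each family of balls. The family of all
  balls is closed under dilation, so the oscillation between a ball and its dilate suffices. If a
  ball outside \<open>large_balls \<rho>\<close> enters it when dilated, its average is bounded by a multiple of
  \<open>K\<close> outright, which suffices because the maximal function of \<open>\<lambda>y. \<bar>f y\<bar>\<close> is nonnegative.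
\<close>

lemma BLO_maximal_functions:
  fixes \<rho> :: "'a \<Rightarrow> real"
  assumes \<rho>: "\<And>x. 0 < \<rho> x" and f: "f \<in> L1_loc \<mu>" and K: "0 < K" "BMO_norm \<mu> \<rho> f \<le> ennreal K"
  defines "b \<equiv> 8 * A ^ 5 + 96 * A ^ 12"
  shows "in_BLO_ext \<mu> \<rho> (HL \<mu> f)" "BLO_norm \<mu> \<rho> (real_of_ereal \<circ> HL \<mu> f) \<le> ennreal (b * K)"
    and "in_BLO_ext \<mu> \<rho> (HL_loc \<mu> \<rho> f)" "BLO_norm \<mu> \<rho> (real_of_ereal \<circ> HL_loc \<mu> \<rho> f) \<le> ennreal (b * K)"
    and "in_BLO_ext \<mu> \<rho> (max_avg \<mu> f)" "BLO_norm \<mu> \<rho> (real_of_ereal \<circ> max_avg \<mu> f) \<le> ennreal (b * K)"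
proof -
  let ?abs = "\<lambda>y. \<bar>f y\<bar>" and ?D = "A ^ 2 * (4 * K)"
  have abs_f: "?abs \<in> L1_loc \<mu>"
    using L1_loc_dev[OF f, of 0] by simp
  have osc_f: "avg \<mu> (ball z r) (\<lambda>y. \<bar>f y - avg \<mu> (ball z r) f\<bar>) \<le> 2 * K" if "0 < r" for z r
    using f K that by (rule avg_dev_le_if_BMO_norm_le)
  have "mean_oscillation \<mu> A f (4 * K)"
  proof unfold_locales
    fix z :: 'a and r :: real assume "0 < r"
    with osc_f[of r z] K(1) show "avg \<mu> (ball z r) (\<lambda>y. \<bar>f y - avg \<mu> (ball z r) f\<bar>) \<le> 4 * K"
      by linarith
  qed (use f K in auto)
  then interpret F: mean_oscillation \<mu> A f "4 * K" .
  have "mean_oscillation \<mu> A ?abs (4 * K)"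
  proof unfold_locales
    fix z :: 'a and r :: real assume r: "0 < r"
    with osc_f[OF r, of z] avg_dev_abs_le[OF f r, of z]
    show "avg \<mu> (ball z r) (\<lambda>y. \<bar>?abs y - avg \<mu> (ball z r) ?abs\<bar>) \<le> 4 * K"
      by linarith
  qed (use abs_f K in auto)
  then interpret H: mean_oscillation \<mu> A ?abs "4 * K" .
  have D: "0 \<le> ?D" "K \<le> ?D"
    using K mult_mono[OF one_le_power[OF A_ge_1, of 2], of K "4 * K"] by auto
  have large: "avg \<mu> (ball z R) ?abs \<le> K" if "\<rho> z \<le> R" for z R
    using \<rho>[of z] that by (intro avg_abs_le_if_BMO_norm_le[OF f K]) auto
  have large': "avg \<mu> (ball z R) ?abs \<le> ?D" "avg \<mu> (ball z R) (\<lambda>y. \<bar>\<bar>f y\<bar>\<bar>) \<le> ?D"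
    if "\<rho> z \<le> R" for z R
    using large[OF that] D(2) by auto
  have const: "2 * (A ^ 3 * ?D + 12 * A ^ 12 * (4 * K)) = b * K"
    unfolding b_def by (simp add: algebra_simps flip: power_add)
  have dilate: "ereal (avg \<mu> (ball z s) g) \<le> max_over \<mu> P g y + ereal ?D"
    if "mean_oscillation \<mu> A g (4 * K)" "0 < s" "(z, 3 * s) \<in> P" "y \<in> ball z (3 * s)" for g P z s y
  proof -
    interpret mean_oscillation \<mu> A g "4 * K" by fact
    have "avg \<mu> (ball z s) g \<le> avg \<mu> (ball z (3 * s)) g + ?D"
      using avg_diff_nested[of s "3 * s" z z 2] that(2) by simp
    then have "ereal (avg \<mu> (ball z s) g) \<le> ereal (avg \<mu> (ball z (3 * s)) g) + ereal ?D"
      by simp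
    also have "\<dots> \<le> max_over \<mu> P g y + ereal ?D"
      using that by (intro add_right_mono avg_le_max_over)
    finally show ?thesis .
  qed
  have far_H: "ereal (avg \<mu> (ball z s) ?abs) \<le> max_over \<mu> balls ?abs y + ereal ?D"
    if "(z, s) \<in> balls" "y \<in> ball z (3 * s)" for z s y
    using that H.mean_oscillation_axioms by (intro dilate) (auto simp: balls_def)
  have far_F: "ereal (avg \<mu> (ball z s) f) \<le> max_over \<mu> balls f y + ereal ?D"
    if "(z, s) \<in> balls" "y \<in> ball z (3 * s)" for z s y
    using that F.mean_oscillation_axioms by (intro dilate) (auto simp: balls_def)
  have far_L: "ereal (avg \<mu> (ball z s) ?abs) \<le> max_over \<mu> (balls - large_balls \<rho>) ?abs y + ereal ?D"
    if "(z, s) \<in> balls - large_balls \<rho>" "y \<in> ball z (3 * s)" for z s y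
  proof (cases "3 * s < \<rho> z")
    case True
    with that H.mean_oscillation_axioms show ?thesis
      by (intro dilate) (auto simp: balls_def large_balls_def)
  next
    case False
    have "0 < s" using that(1) unfolding balls_def by auto
    then have "avg \<mu> (ball z s) ?abs \<le> A ^ 2 * avg \<mu> (ball z (3 * s)) ?abs"
      using abs_f by (intro avg_le_larger_ball) auto
    also have "\<dots> \<le> ?D"
      using large[of z "3 * s"] False K A_ge_1 by (intro mult_left_mono) auto
    finally have "ereal (avg \<mu> (ball z s) ?abs) \<le> 0 + ereal ?D" by simp
    also have "\<dots> \<le> max_over \<mu> (balls - large_balls \<rho>) ?abs y + ereal ?D"
    proof (rule add_right_mono)
      have "0 \<le> ereal (avg \<mu> (ball y (\<rho> y / 2)) ?abs)"
        by (simp add: avg_nonneg)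
      also have "\<dots> \<le> max_over \<mu> (balls - large_balls \<rho>) ?abs y"
        using \<rho>[of y] by (intro avg_le_max_over) (auto simp: balls_def large_balls_def)
      finally show "0 \<le> max_over \<mu> (balls - large_balls \<rho>) ?abs y" .
    qed
    finally show ?thesis .
  qed
  note H_thms = H.BLO_max_over[where \<rho> = \<rho> and P = balls and D = ?D, OF \<rho> subset_refl Diff_subset D(1) far_H large'(2), unfolded const]
  note L_thms = H.BLO_max_over[where \<rho> = \<rho> and P = "balls - large_balls \<rho>" and D = ?D, OF \<rho> Diff_subset subset_refl D(1) far_L large'(2), unfolded const]
  note F_thms = F.BLO_max_over[where \<rho> = \<rho> and P = balls and D = ?D, OF \<rho> subset_refl Diff_subset D(1) far_F large'(1), unfolded const]
  show "in_BLO_ext \<mu> \<rho> (HL \<mu> f)" "BLO_norm \<mu> \<rho> (real_of_ereal \<circ> HL \<mu> f) \<le> ennreal (b * K)"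
    unfolding HL_eq_max_over by (rule H_thms; assumption)+
  show "in_BLO_ext \<mu> \<rho> (HL_loc \<mu> \<rho> f)" "BLO_norm \<mu> \<rho> (real_of_ereal \<circ> HL_loc \<mu> \<rho> f) \<le> ennreal (b * K)"
    unfolding HL_loc_eq_max_over by (rule L_thms; assumption)+
  show "in_BLO_ext \<mu> \<rho> (max_avg \<mu> f)" "BLO_norm \<mu> \<rho> (real_of_ereal \<circ> max_avg \<mu> f) \<le> ennreal (b * K)"
    unfolding max_avg_eq_max_over by (rule F_thms; assumption)+
qed

end

lemma RD_space_doubling:
  assumes "RD_space \<mu>"
  obtains A where "doubling_space \<mu> A"
proof -
  from assms have borel: "sets borel \<subseteq> sets \<mu>"
    and balls: "\<forall>x r. 0 < r \<longrightarrow> 0 < emeasure \<mu> (ball x r) \<and> emeasure \<mu> (ball x r) < \<infinity>"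
    and "\<exists>A\<ge>1. \<forall>x r. 0 < r \<longrightarrow> measure \<mu> (ball x (2 * r)) \<le> A * measure \<mu> (ball x r)"
    unfolding RD_space_def regular_borel_measure_def by simp_all
  then obtain A where "1 \<le> A"
    "\<forall>x r. 0 < r \<longrightarrow> measure \<mu> (ball x (2 * r)) \<le> A * measure \<mu> (ball x r)"
    by auto
  with borel balls have "doubling_space \<mu> A"
    by unfold_locales simp_all
  then show thesis by (rule that)
qed

theorem corollary4p1:
  fixes \<mu> :: "'a::metric_space measure" and \<rho> :: "'a \<Rightarrow> real"
  assumes "RD_space \<mu>" and "admissible \<rho>"
  shows "\<exists>C::real. 0 < C \<and> (\<forall>f \<in> BMO \<mu> \<rho>.
    in_BLO_ext \<mu> \<rho> (HL \<mu> f) \<and>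
    in_BLO_ext \<mu> \<rho> (HL_loc \<mu> \<rho> f) \<and>
    in_BLO_ext \<mu> \<rho> (max_avg \<mu> f) \<and>
    BLO_norm \<mu> \<rho> (real_of_ereal \<circ> HL \<mu> f) +
    BLO_norm \<mu> \<rho> (real_of_ereal \<circ> HL_loc \<mu> \<rho> f) +
    BLO_norm \<mu> \<rho> (real_of_ereal \<circ> max_avg \<mu> f) \<le> ennreal C * BMO_norm \<mu> \<rho> f)"
proof -
  obtain A where "doubling_space \<mu> A"
    using assms(1) by (rule RD_space_doubling)
  then interpret doubling_space \<mu> A .
  have \<rho>: "0 < \<rho> x" for x
    using assms(2) unfolding admissible_def by blast
  define b where "b = 8 * A ^ 5 + 96 * A ^ 12"
  have b: "0 < b" unfolding b_def using A_ge_1 by (simp add: add_pos_pos)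
  show ?thesis
  proof (intro exI[of _ "3 * b"] conjI ballI)
    show "0 < 3 * b" using b by simp
    fix f assume "f \<in> BMO \<mu> \<rho>"
    then have f: "f \<in> L1_loc \<mu>" and "BMO_norm \<mu> \<rho> f < \<infinity>"
      unfolding BMO_def by auto
    then obtain k where k: "BMO_norm \<mu> \<rho> f = ennreal k" "0 \<le> k"
      by (cases "BMO_norm \<mu> \<rho> f") auto
    have K: "0 < k + e" "BMO_norm \<mu> \<rho> f \<le> ennreal (k + e)" if "0 < e" for e
      using k that by (auto intro: ennreal_leI)
    note bounds = BLO_maximal_functions[OF \<rho> f K, folded b_def]
    show "in_BLO_ext \<mu> \<rho> (HL \<mu> f)" "in_BLO_ext \<mu> \<rho> (HL_loc \<mu> \<rho> f)" "in_BLO_ext \<mu> \<rho> (max_avg \<mu> f)"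
      by (rule bounds[OF zero_less_one zero_less_one])+
    show "BLO_norm \<mu> \<rho> (real_of_ereal \<circ> HL \<mu> f) + BLO_norm \<mu> \<rho> (real_of_ereal \<circ> HL_loc \<mu> \<rho> f) +
        BLO_norm \<mu> \<rho> (real_of_ereal \<circ> max_avg \<mu> f) \<le> ennreal (3 * b) * BMO_norm \<mu> \<rho> f"
      (is "?lhs \<le> _")
    proof (rule ennreal_le_epsilon)
      fix e :: real assume e: "0 < e"
      define d where "d = e / (3 * b)"
      have d: "0 < d" using e b unfolding d_def by simp
      have "?lhs \<le> ennreal (b * (k + d)) + ennreal (b * (k + d)) + ennreal (b * (k + d))"
        by (intro add_mono bounds[OF d d])
      also have "\<dots> = ennreal (3 * b * k + e)"
        using b k(2) d e unfolding d_def by (simp add: field_simps flip: ennreal_plus)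
      also have "\<dots> = ennreal (3 * b) * BMO_norm \<mu> \<rho> f + ennreal e"
        using b k e by (simp add: ennreal_plus ennreal_mult)
      finally show "?lhs \<le> ennreal (3 * b) * BMO_norm \<mu> \<rho> f + ennreal e" .
    qed
  qed
qed

end
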